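(* Let $\Lambda$ be a finitely aligned $k$-graph. Then $\Lambda$ is cofinal if and only if the boundary-path groupoid $\mathcal{G}_\Lambda$ is minimal.
   Context: $\mathbb{N}$ contains $0$; for $m,n\in\mathbb{N}^k$ ($k\ge 1$), $m\le n$ and $m\vee n$ (maximum) are taken coordinatewise. A $k$-graph $\Lambda$ is a countable small category with a functor $d:\Lambda\to\mathbb{N}^k$ ($\mathbb{N}^k$ viewed as a category with one object) satisfying the factorisation property: if $d(\lambda)=m+n$ there are unique $\mu,\nu\in\Lambda$ with $\lambda=\mu\nu$, $d(\mu)=m$, $d(\nu)=n$; write $\lambda(0,m)=\mu$, $\lambda(m,m+n)=\nu$. $\Lambda^0$ denotes the objects (vertices), identified with the identity morphisms, i.e. the morphisms of degree $0$. $r(\lambda), s(\lambda)$ are the range (codomain) and source (domain); $\lambda\mu$ is defined when $s(\lambda)=r(\mu)$. $v\Lambda=\{\lambda\in\Lambda: r(\lambda)=v\}$ and $v\Lambda w=\{\lambda\in\Lambda:r(\lambda)=v,s(\lambda)=w\}$. For $\lambda,\mu\in\Lambda$, $\operatorname{MCE}(\lambda,\mu)$ is the set of $\tau\in\Lambda$ with $d(\tau)=d(\lambda)\vee d(\mu)$, $\tau(0,d(\lambda))=\lambda$, $\tau(0,d(\mu))=\mu$, and $\Lambda^{\min}(\lambda,\mu)=\{(\rho,\tau)\in\Lambda\times\Lambda:\lambda\rho=\mu\tau\in\operatorname{MCE}(\lambda,\mu)\}$. $\Lambda$ is finitely aligned if every $\Lambda^{\min}(\lambda,\mu)$ is finite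 (possibly empty). A set $E\subseteq v\Lambda$ is exhaustive if for every $\lambda\in v\Lambda$ there is $\mu\in E$ with $\Lambda^{\min}(\lambda,\mu)\ne\emptyset$. $\operatorname{FE}(\Lambda)$ is the collection of all finite exhaustive sets $E\subseteq v\Lambda\setminus\{v\}$, $v\in\Lambda^0$; for such $E$, $r(E):=v$. Boundary paths: for $m\in(\mathbb{N}\cup\{\infty\})^k$, $\Omega_{k,m}=\{(p,q)\in\mathbb{N}^k\times\mathbb{N}^k:p\le q\le m\}$ is the $k$-graph with objects $\{p\in\mathbb{N}^k:p\le m\}$, $r(p,q)=p$, $s(p,q)=q$, $d(p,q)=q-p$. A boundary path of $\Lambda$ is a degree-preserving functor $x:\Omega_{k,m}\to\Lambda$ such that for every $n\in\mathbb{N}^k$ with $n\le m$ and every $E\in\operatorname{FE}(\Lambda)$ with $r(E)=x(n,n)$ there is $\lambda\in E$ with $n+d(\lambda)\le m$ and $x(n,n+d(\lambda))=\lambda$. Put $d(x)=m$, $x(n)=x(n,n)$, $r(x)=x(0)$. $\partial\Lambda$ is the set of boundary paths; $v\partial\Lambda=\{x\in\partial\Lambda:r(x)=v\}$. For $n\le d(x)$, $\sigma^nx\in\partial\Lambda$ is given by $(\sigma^nx)(p,q)=x(n+p,n+q)$; for $\lambda\in\Lambda$ with $s(\lambda)=r(x)$, $\lambda x\in\partial\Lambda$ is the boundary path with $(\lambda x)(0,d(\lambda))=\lambda$ and $\sigma^{d(\lambda)}(\lambda x)=x$; $\lambda\partial\Lambda=\{\lambda x:x\in s(\lambda)\partial\Lambda\}$.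 Boundary-path groupoid $\mathcal{G}_\Lambda$: unit space $\partial\Lambda$ (with $x$ identified with $(x,0,x)$); morphisms are the triples $(\lambda z,d(\lambda)-d(\mu),\mu z)\in\partial\Lambda\times\mathbb{Z}^k\times\partial\Lambda$ with $\lambda,\mu\in\Lambda$, $s(\lambda)=s(\mu)$, $z\in s(\lambda)\partial\Lambda$; $r(x,m,y)=x$, $s(x,m,y)=y$, $(x,m,y)(y,n,w)=(x,m+n,w)$, $(x,m,y)^{-1}=(y,-m,x)$. For $s(\lambda)=s(\mu)$ and finite non-exhaustive $G\subseteq s(\lambda)\Lambda$, let $Z_\Lambda(\lambda)=\lambda\partial\Lambda$, $Z_\Lambda(\lambda\setminus G)=Z_\Lambda(\lambda)\setminus\bigcup_{\nu\in G}Z_\Lambda(\lambda\nu)$, $Z_\Lambda(\lambda*_s\mu)=\{(x,d(\lambda)-d(\mu),y)\in\mathcal{G}_\Lambda:x\in Z_\Lambda(\lambda),\,y\in Z_\Lambda(\mu),\,\sigma^{d(\lambda)}x=\sigma^{d(\mu)}y\}$ and $Z_\Lambda(\lambda*_s\mu\setminus G)=Z_\Lambda(\lambda*_s\mu)\setminus\bigcup_{\nu\in G}Z_\Lambda(\lambda\nu*_s\mu\nu)$. The sets $Z_\Lambda(\lambda*_s\mu\setminus G)$ form a basis of compact open bisections for a second-countable Hausdorff topology making $\mathcal{G}_\Lambda$ an ample topological groupoid, and the sets $Z_\Lambda(\lambda\setminus G)$ form a basis of compact open sets for the unit space $\partial\Lambda$. $\Lambda$ is cofinal if for all $v\in\Lambda^0$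 and $x\in\partial\Lambda$ there is $n\in\mathbb{N}^k$ with $n\le d(x)$ and $v\Lambda x(n)\neq\emptyset$. In a groupoid $\mathcal{G}$ with unit space $\mathcal{G}^{(0)}$, $U\subseteq\mathcal{G}^{(0)}$ is invariant if $s(a)\in U$ implies $r(a)\in U$ for all $a\in\mathcal{G}$. A topological groupoid $\mathcal{G}$ is minimal if $\mathcal{G}^{(0)}$ has no nontrivial open invariant subsets (i.e. none other than $\emptyset$ and $\mathcal{G}^{(0)}$); equivalently, for each $x\in\mathcal{G}^{(0)}$ the orbit $[x]=\{s(a):r(a)=x\}$ is dense in $\mathcal{G}^{(0)}$. *)

theory Defs
  imports
    "HOL-Analysis.Abstract_Topology"
    "HOL-Library.Function_Algebras"
    "HOL-Library.Extended_Nat"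
    "HOL-Library.FuncSet"
    "HOL-Library.Countable_Set"
begin

section \<open>Categories, \<open>k\<close>-graphs and functors\<close>

text \<open>
  Categories are single-sorted: an object is identified with its identity morphism, so
  \<open>rng\<close> and \<open>src\<close> (codomain and domain) return identity morphisms.  The composite
  \<open>cmp C a b\<close> is meaningful only when \<open>src C a = rng C b\<close>.
\<close>

record 'a cat =
  Mor :: "'a set"
  rng :: "'a \<Rightarrow> 'a"
  src :: "'a \<Rightarrow> 'a"
  cmp :: "'a \<Rightarrow> 'a \<Rightarrow> 'a"

definition Obj :: "('a, 'm) cat_scheme \<Rightarrow> 'a set" where
  "Obj C = {v \<in> Mor C. rng C v = v}"

locale small_category =
  fixes C :: "('a, 'm) cat_scheme"
  assumes rng_closed: "a \<in> Mor C \<Longrightarrow> rng C a \<in> Mor C"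
    and src_closed: "a \<in> Mor C \<Longrightarrow> src C a \<in> Mor C"
    and rng_rng: "a \<in> Mor C \<Longrightarrow> rng C (rng C a) = rng C a"
    and src_rng: "a \<in> Mor C \<Longrightarrow> src C (rng C a) = rng C a"
    and rng_src: "a \<in> Mor C \<Longrightarrow> rng C (src C a) = src C a"
    and src_src: "a \<in> Mor C \<Longrightarrow> src C (src C a) = src C a"
    and cmp_closed: "\<lbrakk>a \<in> Mor C; b \<in> Mor C; src C a = rng C b\<rbrakk> \<Longrightarrow> cmp C a b \<in> Mor C"
    and rng_cmp: "\<lbrakk>a \<in> Mor C; b \<in> Mor C; src C a = rng C b\<rbrakk> \<Longrightarrow> rng C (cmp C a b) = rng C a"
    and src_cmp: "\<lbrakk>a \<in> Mor C; b \<in> Mor C; src C a = rng C b\<rbrakk> \<Longrightarrow> src C (cmp C a b) = src C b"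
    and cmp_rng: "a \<in> Mor C \<Longrightarrow> cmp C (rng C a) a = a"
    and cmp_src: "a \<in> Mor C \<Longrightarrow> cmp C a (src C a) = a"
    and cmp_assoc:
      "\<lbrakk>a \<in> Mor C; b \<in> Mor C; c \<in> Mor C; src C a = rng C b; src C b = rng C c\<rbrakk>
        \<Longrightarrow> cmp C (cmp C a b) c = cmp C a (cmp C b c)"

text \<open>
  The rank \<open>k\<close> is the cardinality of the finite type \<open>'k\<close>; order, supremum and addition
  of degrees are the pointwise ones on \<open>'k \<Rightarrow> nat\<close>.
\<close>

record ('a, 'k) kgraph = "'a cat" +
  deg :: "'a \<Rightarrow> 'k \<Rightarrow> nat"

locale k_graph = small_category \<Lambda>
  for \<Lambda> :: "('a, 'k::finite) kgraph" +
  assumes countable_Mor: "countable (Mor \<Lambda>)"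
    and deg_Obj: "v \<in> Obj \<Lambda> \<Longrightarrow> deg \<Lambda> v = 0"
    and deg_cmp:
      "\<lbrakk>a \<in> Mor \<Lambda>; b \<in> Mor \<Lambda>; src \<Lambda> a = rng \<Lambda> b\<rbrakk>
        \<Longrightarrow> deg \<Lambda> (cmp \<Lambda> a b) = deg \<Lambda> a + deg \<Lambda> b"
    and factorisation:
      "\<lbrakk>a \<in> Mor \<Lambda>; deg \<Lambda> a = m + n\<rbrakk>
        \<Longrightarrow> \<exists>!(\<mu>, \<nu>). \<mu> \<in> Mor \<Lambda> \<and> \<nu> \<in> Mor \<Lambda> \<and> src \<Lambda> \<mu> = rng \<Lambda> \<nu> \<and>
              a = cmp \<Lambda> \<mu> \<nu> \<and> deg \<Lambda> \<mu> = m \<and> deg \<Lambda> \<nu> = n"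

lemma (in k_graph) Obj_eq_deg_0: "Obj \<Lambda> = {a \<in> Mor \<Lambda>. deg \<Lambda> a = 0}"
proof (intro equalityI subsetI)
  fix a assume "a \<in> Obj \<Lambda>"
  then show "a \<in> {a \<in> Mor \<Lambda>. deg \<Lambda> a = 0}"
    using deg_Obj by (simp add: Obj_def)
next
  fix a assume "a \<in> {a \<in> Mor \<Lambda>. deg \<Lambda> a = 0}"
  then have a: "a \<in> Mor \<Lambda>" and d: "deg \<Lambda> a = 0" by auto
  have rs: "rng \<Lambda> a \<in> Obj \<Lambda>" "src \<Lambda> a \<in> Obj \<Lambda>"
    using a by (simp_all add: Obj_def rng_closed src_closed rng_rng rng_src)
  then have d0: "deg \<Lambda> (rng \<Lambda> a) = 0" "deg \<Lambda> (src \<Lambda> a) = 0"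
    by (simp_all only: deg_Obj)
  let ?P = "\<lambda>(\<mu>, \<nu>). \<mu> \<in> Mor \<Lambda> \<and> \<nu> \<in> Mor \<Lambda> \<and> src \<Lambda> \<mu> = rng \<Lambda> \<nu> \<and>
    a = cmp \<Lambda> \<mu> \<nu> \<and> deg \<Lambda> \<mu> = 0 \<and> deg \<Lambda> \<nu> = 0"
  have u: "\<exists>!p. ?P p"
    using factorisation[OF a, of 0 0] d by simp
  have "?P (rng \<Lambda> a, a)"
    using a d d0 by (simp add: rng_closed src_rng cmp_rng)
  moreover have "?P (a, src \<Lambda> a)"
    using a d d0 by (simp add: src_closed rng_src cmp_src)
  ultimately have "(rng \<Lambda> a, a) = (a, src \<Lambda> a)"
    by (rule the1_equality[OF u, symmetric, THEN trans, OF _ the1_equality[OF u]])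
  then show "a \<in> Obj \<Lambda>" using a by (simp add: Obj_def)
qed

text \<open>
  On a single-sorted category, preserving \<open>rng\<close> and \<open>src\<close> as morphisms includes the
  preservation of identities.  Functors are extensional outside the morphisms of \<open>C\<close>, so
  that equality of functors is equality in HOL.
\<close>

definition functors ::
    "('a, 'm) cat_scheme \<Rightarrow> ('b, 'n) cat_scheme \<Rightarrow> ('a \<Rightarrow> 'b) set" where
  "functors C D = {F \<in> Mor C \<rightarrow>\<^sub>E Mor D.
     (\<forall>a\<in>Mor C. F (rng C a) = rng D (F a) \<and> F (src C a) = src D (F a)) \<and>
     (\<forall>a\<in>Mor C. \<forall>b\<in>Mor C. src C a = rng C b \<longrightarrow> F (cmp C a b) = cmp D (F a) (F b))}"


section \<open>Minimal common extensions and exhaustive sets\<close>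

text \<open>The initial segment \<open>a(0, m)\<close>, meaningful when \<open>m \<le> deg \<Lambda> a\<close>.\<close>

definition initial :: "('a, 'k) kgraph \<Rightarrow> 'a \<Rightarrow> ('k \<Rightarrow> nat) \<Rightarrow> 'a" where
  "initial \<Lambda> a m = (THE \<mu>. \<mu> \<in> Mor \<Lambda> \<and> deg \<Lambda> \<mu> = m \<and>
     (\<exists>\<nu>\<in>Mor \<Lambda>. src \<Lambda> \<mu> = rng \<Lambda> \<nu> \<and> a = cmp \<Lambda> \<mu> \<nu>))"

definition MCE :: "('a, 'k) kgraph \<Rightarrow> 'a \<Rightarrow> 'a \<Rightarrow> 'a set" where
  "MCE \<Lambda> \<alpha> \<beta> = {\<tau> \<in> Mor \<Lambda>. deg \<Lambda> \<tau> = sup (deg \<Lambda> \<alpha>) (deg \<Lambda> \<beta>) \<and>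
     initial \<Lambda> \<tau> (deg \<Lambda> \<alpha>) = \<alpha> \<and> initial \<Lambda> \<tau> (deg \<Lambda> \<beta>) = \<beta>}"

definition Lmin :: "('a, 'k) kgraph \<Rightarrow> 'a \<Rightarrow> 'a \<Rightarrow> ('a \<times> 'a) set" where
  "Lmin \<Lambda> \<alpha> \<beta> = {(\<rho>, \<tau>) \<in> Mor \<Lambda> \<times> Mor \<Lambda>.
     src \<Lambda> \<alpha> = rng \<Lambda> \<rho> \<and> src \<Lambda> \<beta> = rng \<Lambda> \<tau> \<and>
     cmp \<Lambda> \<alpha> \<rho> = cmp \<Lambda> \<beta> \<tau> \<and> cmp \<Lambda> \<alpha> \<rho> \<in> MCE \<Lambda> \<alpha> \<beta>}"

definition finitely_aligned :: "('a, 'k) kgraph \<Rightarrow> bool" where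
  "finitely_aligned \<Lambda> \<longleftrightarrow> (\<forall>\<alpha>\<in>Mor \<Lambda>. \<forall>\<beta>\<in>Mor \<Lambda>. finite (Lmin \<Lambda> \<alpha> \<beta>))"

definition into :: "('a, 'k) kgraph \<Rightarrow> 'a \<Rightarrow> 'a set" where
  "into \<Lambda> v = {a \<in> Mor \<Lambda>. rng \<Lambda> a = v}"

definition exhaustive :: "('a, 'k) kgraph \<Rightarrow> 'a \<Rightarrow> 'a set \<Rightarrow> bool" where
  "exhaustive \<Lambda> v E \<longleftrightarrow> E \<subseteq> into \<Lambda> v \<and> (\<forall>\<alpha>\<in>into \<Lambda> v. \<exists>\<beta>\<in>E. Lmin \<Lambda> \<alpha> \<beta> \<noteq> {})"

text \<open>
  \<open>FE \<Lambda> v\<close> consists of the finite exhaustive sets \<open>E\<close> with \<open>r(E) = v\<close>.  Such an \<open>E\<close> is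
  nonempty because \<open>v\<close> itself has to have a common extension with a member of \<open>E\<close>, so
  \<open>E\<close> determines \<open>v\<close>.
\<close>

definition FE :: "('a, 'k) kgraph \<Rightarrow> 'a \<Rightarrow> 'a set set" where
  "FE \<Lambda> v = {E. v \<in> Obj \<Lambda> \<and> finite E \<and> E \<subseteq> into \<Lambda> v - {v} \<and> exhaustive \<Lambda> v E}"


section \<open>Boundary paths\<close>

definition edeg :: "('k \<Rightarrow> nat) \<Rightarrow> 'k \<Rightarrow> enat" where
  "edeg n = (\<lambda>i. enat (n i))"

definition Omega :: "('k \<Rightarrow> enat) \<Rightarrow> (('k \<Rightarrow> nat) \<times> ('k \<Rightarrow> nat), 'k) kgraph" where
  "Omega m = \<lparr>Mor = {(p, q). p \<le> q \<and> edeg q \<le> m},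
     rng = (\<lambda>(p, q). (p, p)), src = (\<lambda>(p, q). (q, q)),
     cmp = (\<lambda>(p, q) (p', q'). (p, q')), deg = (\<lambda>(p, q). q - p)\<rparr>"

text \<open>
  A path is a pair of its degree \<open>m\<close> and a functor on \<open>Omega m\<close>; \<open>pmor x p q\<close> is
  \<open>x(p, q)\<close>, and the vertex \<open>x(n)\<close> is the identity morphism \<open>pmor x n n\<close>.
\<close>

type_synonym ('a, 'k) path = "('k \<Rightarrow> enat) \<times> (('k \<Rightarrow> nat) \<times> ('k \<Rightarrow> nat) \<Rightarrow> 'a)"

abbreviation pdeg :: "('a, 'k) path \<Rightarrow> 'k \<Rightarrow> enat" where
  "pdeg x \<equiv> fst x"

abbreviation pmor :: "('a, 'k) path \<Rightarrow> ('k \<Rightarrow> nat) \<Rightarrow> ('k \<Rightarrow> nat) \<Rightarrow> 'a" where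
  "pmor x p q \<equiv> snd x (p, q)"

definition boundary_paths :: "('a, 'k) kgraph \<Rightarrow> ('a, 'k) path set" where
  "boundary_paths \<Lambda> = {x.
     snd x \<in> functors (Omega (pdeg x)) \<Lambda> \<and>
     (\<forall>a\<in>Mor (Omega (pdeg x)). deg \<Lambda> (snd x a) = deg (Omega (pdeg x)) a) \<and>
     (\<forall>n. edeg n \<le> pdeg x \<longrightarrow>
        (\<forall>E\<in>FE \<Lambda> (pmor x n n). \<exists>\<alpha>\<in>E.
           edeg (n + deg \<Lambda> \<alpha>) \<le> pdeg x \<and> pmor x n (n + deg \<Lambda> \<alpha>) = \<alpha>))}"

definition boundary_paths_at :: "('a, 'k) kgraph \<Rightarrow> 'a \<Rightarrow> ('a, 'k) path set" where
  "boundary_paths_at \<Lambda> v = {x \<in> boundary_paths \<Lambda>. pmor x 0 0 = v}"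

definition shift :: "('k \<Rightarrow> nat) \<Rightarrow> ('a, 'k) path \<Rightarrow> ('a, 'k) path" where
  "shift n x = (let m = (\<lambda>i. pdeg x i - enat (n i)) in
     (m, restrict (\<lambda>(p, q). pmor x (n + p) (n + q)) (Mor (Omega m))))"

text \<open>The concatenation \<open>\<alpha>x\<close>, meaningful when \<open>src \<Lambda> \<alpha>\<close> is the range of \<open>x\<close>.\<close>

definition prepend :: "('a, 'k) kgraph \<Rightarrow> 'a \<Rightarrow> ('a, 'k) path \<Rightarrow> ('a, 'k) path" where
  "prepend \<Lambda> \<alpha> x = (THE y. y \<in> boundary_paths \<Lambda> \<and> edeg (deg \<Lambda> \<alpha>) \<le> pdeg y \<and>
     pmor y 0 (deg \<Lambda> \<alpha>) = \<alpha> \<and> shift (deg \<Lambda> \<alpha>) y = x)"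

definition cofinal_kgraph :: "('a, 'k) kgraph \<Rightarrow> bool" where
  "cofinal_kgraph \<Lambda> \<longleftrightarrow> (\<forall>v\<in>Obj \<Lambda>. \<forall>x\<in>boundary_paths \<Lambda>.
     \<exists>n. edeg n \<le> pdeg x \<and> {a \<in> Mor \<Lambda>. rng \<Lambda> a = v \<and> src \<Lambda> a = pmor x n n} \<noteq> {})"


section \<open>Groupoids and the boundary-path groupoid\<close>

record 'g groupoid = "'g cat" +
  ginv :: "'g \<Rightarrow> 'g"

definition invariant :: "'g groupoid \<Rightarrow> 'g set \<Rightarrow> bool" where
  "invariant G U \<longleftrightarrow> U \<subseteq> Obj G \<and> (\<forall>a\<in>Mor G. src G a \<in> U \<longrightarrow> rng G a \<in> U)"

definition minimal_groupoid :: "'g groupoid \<Rightarrow> 'g topology \<Rightarrow> bool" where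
  "minimal_groupoid G T \<longleftrightarrow>
     (\<forall>U. openin (subtopology T (Obj G)) U \<and> invariant G U \<longrightarrow> U = {} \<or> U = Obj G)"

type_synonym ('a, 'k) bp_arrow = "('a, 'k) path \<times> ('k \<Rightarrow> int) \<times> ('a, 'k) path"

definition deg_diff :: "('a, 'k) kgraph \<Rightarrow> 'a \<Rightarrow> 'a \<Rightarrow> 'k \<Rightarrow> int" where
  "deg_diff \<Lambda> \<alpha> \<beta> = (\<lambda>i. int (deg \<Lambda> \<alpha> i) - int (deg \<Lambda> \<beta> i))"

text \<open>The unit space is the set of triples \<open>(x, 0, x)\<close> for boundary paths \<open>x\<close>.\<close>

definition bp_groupoid :: "('a, 'k) kgraph \<Rightarrow> ('a, 'k) bp_arrow groupoid" where
  "bp_groupoid \<Lambda> = \<lparr>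
     Mor = {(prepend \<Lambda> \<alpha> z, deg_diff \<Lambda> \<alpha> \<beta>, prepend \<Lambda> \<beta> z) | \<alpha> \<beta> z.
              \<alpha> \<in> Mor \<Lambda> \<and> \<beta> \<in> Mor \<Lambda> \<and> src \<Lambda> \<alpha> = src \<Lambda> \<beta> \<and>
              z \<in> boundary_paths_at \<Lambda> (src \<Lambda> \<alpha>)},
     rng = (\<lambda>(x, m, y). (x, 0, x)), src = (\<lambda>(x, m, y). (y, 0, y)),
     cmp = (\<lambda>(x, m, y) (y', n, w). (x, m + n, w)),
     ginv = (\<lambda>(x, m, y). (y, - m, x))\<rparr>"

definition cylinder :: "('a, 'k) kgraph \<Rightarrow> 'a \<Rightarrow> ('a, 'k) path set" where
  "cylinder \<Lambda> \<alpha> = prepend \<Lambda> \<alpha> ` boundary_paths_at \<Lambda> (src \<Lambda> \<alpha>)"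

definition cylinder2 :: "('a, 'k) kgraph \<Rightarrow> 'a \<Rightarrow> 'a \<Rightarrow> ('a, 'k) bp_arrow set" where
  "cylinder2 \<Lambda> \<alpha> \<beta> = {(x, m, y) \<in> Mor (bp_groupoid \<Lambda>). m = deg_diff \<Lambda> \<alpha> \<beta> \<and>
     x \<in> cylinder \<Lambda> \<alpha> \<and> y \<in> cylinder \<Lambda> \<beta> \<and> shift (deg \<Lambda> \<alpha>) x = shift (deg \<Lambda> \<beta>) y}"

definition cylinder2_minus ::
    "('a, 'k) kgraph \<Rightarrow> 'a \<Rightarrow> 'a \<Rightarrow> 'a set \<Rightarrow> ('a, 'k) bp_arrow set" where
  "cylinder2_minus \<Lambda> \<alpha> \<beta> F =
     cylinder2 \<Lambda> \<alpha> \<beta> - (\<Union>\<nu>\<in>F. cylinder2 \<Lambda> (cmp \<Lambda> \<alpha> \<nu>) (cmp \<Lambda> \<beta> \<nu>))"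

definition bp_basis :: "('a, 'k) kgraph \<Rightarrow> ('a, 'k) bp_arrow set set" where
  "bp_basis \<Lambda> = {cylinder2_minus \<Lambda> \<alpha> \<beta> F | \<alpha> \<beta> F.
     \<alpha> \<in> Mor \<Lambda> \<and> \<beta> \<in> Mor \<Lambda> \<and> src \<Lambda> \<alpha> = src \<Lambda> \<beta> \<and>
     finite F \<and> F \<subseteq> into \<Lambda> (src \<Lambda> \<alpha>) \<and> \<not> exhaustive \<Lambda> (src \<Lambda> \<alpha>) F}"

text \<open>
  For a finitely aligned \<open>k\<close>-graph \<open>bp_basis \<Lambda>\<close> is a basis, so the generated topology
  consists of the unions of its members; the unit space carries the subspace topology.
\<close>

definition bp_topology :: "('a, 'k) kgraph \<Rightarrow> ('a, 'k) bp_arrow topology" where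
  "bp_topology \<Lambda> = topology_generated_by (bp_basis \<Lambda>)"

end

theory Submission imports Defs begin

text \<open>
  A path is determined by its set of initial segments, a nonempty directed downward closed set
  of morphisms for the prefix order, and every such set arises in this way; being a boundary
  path is a condition on this set.

  If \<open>\<Lambda>\<close> is cofinal, let \<open>U\<close> be open, invariant and nonempty.  The boundary condition at a point
  of \<open>U\<close> yields a morphism \<open>b\<close> all of whose boundary paths \<open>bz\<close> lie in \<open>U\<close>.  By cofinality any
  boundary path \<open>y\<close> has a vertex \<open>y(n)\<close> that is connected to \<open>src b\<close> by some \<open>c\<close>, and
  \<open>bc\<sigma>\<^sup>ny \<in> U\<close> lies in the orbit of \<open>y\<close>.  Conversely, the boundary paths passing through a vertex
  that is connected to \<open>v\<close> form an open invariant set, which is nonempty because every vertex is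
  the range of a boundary path.
\<close>

section \<open>Prefixes and common extensions\<close>

context k_graph
begin

text \<open>Working with initial segments avoids handling functors on \<open>Omega m\<close> with
  partly infinite \<open>m\<close>: a concatenation \<open>ax\<close> becomes the downward closure
  of the products \<open>ac\<close>, and the limit of an increasing chain becomes the set of
  prefixes of its terms. Directedness replaces linear order, since two initial segments of a path
  are in general incomparable when the rank exceeds 1. The obstacle is that basic neighbourhoods are
  cylinders with finitely many smaller ones removed, and that the boundary condition speaks of
  exhaustive sets based at a vertex of the path, while the sets at hand are based elsewhere. Both
  are met by \<open>Ext b E\<close>, which transports a finite set \<open>E\<close> along
  \<open>b\<close>, preserves exhaustiveness, and stays finite by finite alignment. It shows that
  concatenations are boundary paths, and that an initial segment of a boundary path avoiding
  finitely many morphisms can be prolonged, possibly off the path, so as to have no common extension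
  with any of them.\<close>

definition prefix_of :: "'a \<Rightarrow> 'a \<Rightarrow> bool" (infix "\<sqsubseteq>" 50) where
  "a \<sqsubseteq> b \<longleftrightarrow> a \<in> Mor \<Lambda> \<and> (\<exists>c\<in>Mor \<Lambda>. src \<Lambda> a = rng \<Lambda> c \<and> b = cmp \<Lambda> a c)"

lemma prefix_ofI:
  "\<lbrakk>a \<in> Mor \<Lambda>; c \<in> Mor \<Lambda>; src \<Lambda> a = rng \<Lambda> c\<rbrakk> \<Longrightarrow> a \<sqsubseteq> cmp \<Lambda> a c"
  by (auto simp: prefix_of_def)

lemma prefix_ofE:
  assumes "a \<sqsubseteq> b"
  obtains c where "a \<in> Mor \<Lambda>" "c \<in> Mor \<Lambda>" "src \<Lambda> a = rng \<Lambda> c" "b = cmp \<Lambda> a c"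
  using assms by (auto simp: prefix_of_def)

lemma prefix_Mor: "a \<sqsubseteq> b \<Longrightarrow> a \<in> Mor \<Lambda>" "a \<sqsubseteq> b \<Longrightarrow> b \<in> Mor \<Lambda>"
  by (auto simp: prefix_of_def cmp_closed)

lemma prefix_deg_le: "a \<sqsubseteq> b \<Longrightarrow> deg \<Lambda> a \<le> deg \<Lambda> b"
  by (auto simp: prefix_of_def deg_cmp le_fun_def)

lemma prefix_rng: "a \<sqsubseteq> b \<Longrightarrow> rng \<Lambda> b = rng \<Lambda> a"
  by (auto simp: prefix_of_def rng_cmp)

lemma prefix_refl: "a \<in> Mor \<Lambda> \<Longrightarrow> a \<sqsubseteq> a"
  using prefix_ofI[of a "src \<Lambda> a"] by (simp add: cmp_src src_closed rng_src)

lemma prefix_trans: "\<lbrakk>a \<sqsubseteq> b; b \<sqsubseteq> c\<rbrakk> \<Longrightarrow> a \<sqsubseteq> c"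
  by (elim prefix_ofE) (auto simp: cmp_assoc src_cmp rng_cmp cmp_closed intro!: prefix_ofI)

lemma src_Obj: "a \<in> Mor \<Lambda> \<Longrightarrow> src \<Lambda> a \<in> Obj \<Lambda>"
  by (simp add: Obj_def src_closed rng_src)

lemma Obj_Mor: "v \<in> Obj \<Lambda> \<Longrightarrow> v \<in> Mor \<Lambda>"
  and Obj_rng: "v \<in> Obj \<Lambda> \<Longrightarrow> rng \<Lambda> v = v"
  and Obj_src: "v \<in> Obj \<Lambda> \<Longrightarrow> src \<Lambda> v = v"
  using src_rng[of v] by (auto simp: Obj_def)

lemma deg_0_Obj: "\<lbrakk>a \<in> Mor \<Lambda>; deg \<Lambda> a = 0\<rbrakk> \<Longrightarrow> a \<in> Obj \<Lambda>"
  by (simp add: Obj_eq_deg_0)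

text \<open>The factorisation axiom prescribes both degrees; here the second is forced by the first,
  by cancellation in each coordinate.\<close>

lemma factorisation_unique:
  assumes "a \<in> Mor \<Lambda>" "b \<in> Mor \<Lambda>" "src \<Lambda> a = rng \<Lambda> b"
    and "a' \<in> Mor \<Lambda>" "b' \<in> Mor \<Lambda>" "src \<Lambda> a' = rng \<Lambda> b'"
    and "cmp \<Lambda> a b = cmp \<Lambda> a' b'" "deg \<Lambda> a = deg \<Lambda> a'"
  shows "a = a' \<and> b = b'"
proof -
  have "deg \<Lambda> a + deg \<Lambda> b = deg \<Lambda> a' + deg \<Lambda> b'"
    using assms deg_cmp by metis
  then have "deg \<Lambda> b = deg \<Lambda> b'" by (simp add: assms(8) fun_eq_iff)
  moreover have "\<exists>!(\<mu>, \<nu>). \<mu> \<in> Mor \<Lambda> \<and> \<nu> \<in> Mor \<Lambda> \<and> src \<Lambda> \<mu> = rng \<Lambda> \<nu> \<and>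
      cmp \<Lambda> a b = cmp \<Lambda> \<mu> \<nu> \<and> deg \<Lambda> \<mu> = deg \<Lambda> a \<and> deg \<Lambda> \<nu> = deg \<Lambda> b"
    using assms(1-3) by (intro factorisation) (auto simp: cmp_closed deg_cmp)
  ultimately have "(a, b) = (a', b')"
    using assms by (elim ex1E) (smt (verit) case_prodI)
  then show ?thesis by simp
qed

lemma cmp_left_cancel:
  "\<lbrakk>a \<in> Mor \<Lambda>; b \<in> Mor \<Lambda>; c \<in> Mor \<Lambda>; src \<Lambda> a = rng \<Lambda> b; src \<Lambda> a = rng \<Lambda> c;
    cmp \<Lambda> a b = cmp \<Lambda> a c\<rbrakk> \<Longrightarrow> b = c"
  using factorisation_unique[of a b a c] by simp

lemma prefix_unique: "\<lbrakk>a \<sqsubseteq> c; b \<sqsubseteq> c; deg \<Lambda> a = deg \<Lambda> b\<rbrakk> \<Longrightarrow> a = b"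
  by (elim prefix_ofE) (use factorisation_unique in auto)

lemma prefix_exists:
  assumes a: "a \<in> Mor \<Lambda>" and n: "n \<le> deg \<Lambda> a"
  shows "\<exists>b. b \<sqsubseteq> a \<and> deg \<Lambda> b = n"
proof -
  have "deg \<Lambda> a = n + (deg \<Lambda> a - n)" using n by (auto simp: le_fun_def fun_eq_iff)
  from factorisation[OF a this] show ?thesis by (auto simp: prefix_of_def)
qed

text \<open>Prefixes of a fixed morphism are determined by their degrees: the prefix of
  \<open>b\<close> of degree \<open>deg \<Lambda> a\<close> is also a prefix of \<open>c\<close>,
  hence it is \<open>a\<close>.\<close>

lemma prefix_chain:
  assumes "a \<sqsubseteq> c" "b \<sqsubseteq> c" "deg \<Lambda> a \<le> deg \<Lambda> b"
  shows "a \<sqsubseteq> b"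
proof -
  obtain a' where a': "a' \<sqsubseteq> b" "deg \<Lambda> a' = deg \<Lambda> a"
    using prefix_exists[OF prefix_Mor(1)] assms by blast
  then have "a' = a" using prefix_trans[OF a'(1) assms(2)] assms(1) prefix_unique by blast
  then show ?thesis using a' by simp
qed

text \<open>Left translation by \<open>a\<close> preserves the prefix order by associativity and
  reflects it by left cancellation. This moves questions about common extensions to and from the
  vertex \<open>src \<Lambda> a\<close>.\<close>

lemma prefix_cmp_iff:
  assumes "a \<in> Mor \<Lambda>" "b \<in> Mor \<Lambda>" "c \<in> Mor \<Lambda>" "src \<Lambda> a = rng \<Lambda> b" "src \<Lambda> a = rng \<Lambda> c"
  shows "cmp \<Lambda> a b \<sqsubseteq> cmp \<Lambda> a c \<longleftrightarrow> b \<sqsubseteq> c"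
proof
  assume "cmp \<Lambda> a b \<sqsubseteq> cmp \<Lambda> a c"
  then obtain d where d: "d \<in> Mor \<Lambda>" "src \<Lambda> b = rng \<Lambda> d" "cmp \<Lambda> a c = cmp \<Lambda> (cmp \<Lambda> a b) d"
    by (elim prefix_ofE) (use assms in \<open>auto simp: src_cmp\<close>)
  then have "cmp \<Lambda> a c = cmp \<Lambda> a (cmp \<Lambda> b d)" using assms by (simp add: cmp_assoc)
  then have "c = cmp \<Lambda> b d"
    by (rule cmp_left_cancel[rotated 5]) (use assms d(1,2) in \<open>simp_all add: cmp_closed rng_cmp\<close>)
  then show "b \<sqsubseteq> c" using assms d by (simp add: prefix_ofI)
next
  assume "b \<sqsubseteq> c"
  then obtain d where d: "d \<in> Mor \<Lambda>" "src \<Lambda> b = rng \<Lambda> d" "c = cmp \<Lambda> b d"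
    by (elim prefix_ofE)
  then have "cmp \<Lambda> a c = cmp \<Lambda> (cmp \<Lambda> a b) d" using assms by (simp add: cmp_assoc)
  then show "cmp \<Lambda> a b \<sqsubseteq> cmp \<Lambda> a c"
    using assms d by (simp only:) (intro prefix_ofI, auto simp: cmp_closed src_cmp)
qed

text \<open>A morphism has exactly one prefix of each degree below its own, so the definite
  description in \<open>initial\<close> is well defined and can be traded for the prefix
  order.\<close>

lemma initial_eq_iff:
  assumes "t \<in> Mor \<Lambda>" "deg \<Lambda> a \<le> deg \<Lambda> t"
  shows "initial \<Lambda> t (deg \<Lambda> a) = a \<longleftrightarrow> a \<sqsubseteq> t"
proof -
  obtain b where b: "b \<sqsubseteq> t" "deg \<Lambda> b = deg \<Lambda> a" using prefix_exists assms by blast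
  have "initial \<Lambda> t (deg \<Lambda> a) = (THE \<mu>. \<mu> \<sqsubseteq> t \<and> deg \<Lambda> \<mu> = deg \<Lambda> a)"
    unfolding initial_def prefix_of_def by (rule arg_cong[of _ _ The]) auto
  also have "\<dots> = b" using b prefix_unique by (intro the_equality) auto
  finally show ?thesis using b prefix_unique by metis
qed

text \<open>The two \<open>initial\<close> conditions in \<open>MCE\<close> hold automatically, as
  \<open>a\<close> and \<open>b\<close> are prefixes of the common product; only the condition on
  the degree remains.\<close>

lemma mem_Lmin_iff:
  "(p, q) \<in> Lmin \<Lambda> a b \<longleftrightarrow> p \<in> Mor \<Lambda> \<and> q \<in> Mor \<Lambda> \<and> src \<Lambda> a = rng \<Lambda> p \<and> src \<Lambda> b = rng \<Lambda> q \<and>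
     cmp \<Lambda> a p = cmp \<Lambda> b q \<and> deg \<Lambda> (cmp \<Lambda> a p) = sup (deg \<Lambda> a) (deg \<Lambda> b)"
  if ab: "a \<in> Mor \<Lambda>" "b \<in> Mor \<Lambda>"
proof -
  have "cmp \<Lambda> a p \<in> MCE \<Lambda> a b \<longleftrightarrow> deg \<Lambda> (cmp \<Lambda> a p) = sup (deg \<Lambda> a) (deg \<Lambda> b)"
    if *: "p \<in> Mor \<Lambda>" "q \<in> Mor \<Lambda>" "src \<Lambda> a = rng \<Lambda> p" "src \<Lambda> b = rng \<Lambda> q"
      "cmp \<Lambda> a p = cmp \<Lambda> b q"
  proof -
    have 1: "a \<sqsubseteq> cmp \<Lambda> a p" "b \<sqsubseteq> cmp \<Lambda> a p"
      using prefix_ofI[of a p] prefix_ofI[of b q] * ab by auto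
    then show ?thesis
      using initial_eq_iff[OF prefix_Mor(2) prefix_deg_le] by (auto simp: MCE_def prefix_Mor(2))
  qed
  then show ?thesis unfolding Lmin_def by auto
qed

text \<open>Cutting a common extension \<open>t\<close> at the supremum of the two degrees leaves a
  minimal one, since \<open>a\<close> and \<open>b\<close> still lie below the cut.\<close>

lemma Lmin_below:
  assumes "a \<sqsubseteq> t" "b \<sqsubseteq> t"
  obtains p q where "(p, q) \<in> Lmin \<Lambda> a b" "cmp \<Lambda> a p \<sqsubseteq> t"
proof -
  obtain u where u: "u \<sqsubseteq> t" "deg \<Lambda> u = sup (deg \<Lambda> a) (deg \<Lambda> b)"
    using prefix_exists[of t "sup (deg \<Lambda> a) (deg \<Lambda> b)"] assms
    by (metis prefix_Mor(2) prefix_deg_le sup.bounded_iff)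
  then have "a \<sqsubseteq> u" "b \<sqsubseteq> u"
    using prefix_chain[OF assms(1) u(1)] prefix_chain[OF assms(2) u(1)] by simp_all
  then obtain p q where pq: "p \<in> Mor \<Lambda>" "src \<Lambda> a = rng \<Lambda> p" "u = cmp \<Lambda> a p"
      "q \<in> Mor \<Lambda>" "src \<Lambda> b = rng \<Lambda> q" "u = cmp \<Lambda> b q"
    unfolding prefix_of_def by blast
  have "(p, q) \<in> Lmin \<Lambda> a b"
    using pq(1,2,4,5) u(2) assms pq(3)[symmetric] pq(6)[symmetric]
    by (simp add: mem_Lmin_iff prefix_Mor)
  then show thesis using that u(1) pq(3) by blast
qed

lemma Lmin_nonempty_iff:
  assumes "a \<in> Mor \<Lambda>" "b \<in> Mor \<Lambda>"
  shows "Lmin \<Lambda> a b \<noteq> {} \<longleftrightarrow> (\<exists>t. a \<sqsubseteq> t \<and> b \<sqsubseteq> t)"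
proof
  assume "Lmin \<Lambda> a b \<noteq> {}"
  then obtain p q where "(p, q) \<in> Lmin \<Lambda> a b" by auto
  then show "\<exists>t. a \<sqsubseteq> t \<and> b \<sqsubseteq> t"
    using prefix_ofI[of a p] prefix_ofI[of b q] assms by (auto simp: mem_Lmin_iff)
qed (use Lmin_below in blast)

text \<open>Arbitrary common extensions may replace minimal ones, so exhaustiveness becomes a
  statement about the prefix order alone.\<close>

lemma exhaustive_iff:
  "exhaustive \<Lambda> v E \<longleftrightarrow>
     E \<subseteq> into \<Lambda> v \<and> (\<forall>a\<in>into \<Lambda> v. \<exists>b\<in>E. \<exists>t. a \<sqsubseteq> t \<and> b \<sqsubseteq> t)"
proof -
  have "Lmin \<Lambda> a b \<noteq> {} \<longleftrightarrow> (\<exists>t. a \<sqsubseteq> t \<and> b \<sqsubseteq> t)"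
    if "a \<in> into \<Lambda> v" "b \<in> E" "E \<subseteq> into \<Lambda> v" for a b
    using that by (intro Lmin_nonempty_iff) (auto simp: into_def)
  then show ?thesis unfolding exhaustive_def by blast
qed

text \<open>The products \<open>bp\<close> with \<open>p\<close> in \<open>Ext b E\<close> are the
  minimal common extensions of \<open>b\<close> with members of \<open>E\<close>; so
  \<open>Ext b E\<close> is what remains of \<open>E\<close> once \<open>b\<close> has been
  traversed.\<close>

definition Ext :: "'a \<Rightarrow> 'a set \<Rightarrow> 'a set" where
  "Ext b E = (\<Union>e\<in>E. fst ` Lmin \<Lambda> b e)"

lemma mem_ExtE:
  assumes "p \<in> Ext b E" "b \<in> Mor \<Lambda>" "E \<subseteq> Mor \<Lambda>"
  obtains e where "e \<in> E" "p \<in> Mor \<Lambda>" "src \<Lambda> b = rng \<Lambda> p" "e \<sqsubseteq> cmp \<Lambda> b p"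
proof -
  obtain e q where e: "e \<in> E" "(p, q) \<in> Lmin \<Lambda> b e"
    using assms(1) by (auto simp: Ext_def)
  then have "e \<in> Mor \<Lambda>" using assms by auto
  with e prefix_ofI[of e q] assms that show thesis by (auto simp: mem_Lmin_iff)
qed

lemma Ext_below:
  assumes "b \<sqsubseteq> t" "e \<sqsubseteq> t" "e \<in> E"
  obtains p where "p \<in> Ext b E" "cmp \<Lambda> b p \<sqsubseteq> t"
  by (rule Lmin_below[OF assms(1,2)]) (use assms(3) that in \<open>force simp: Ext_def\<close>)

text \<open>Finite alignment enters the proof here: each \<open>Lmin \<Lambda> b e\<close> is
  finite.\<close>

lemma finite_Ext:
  "\<lbrakk>finitely_aligned \<Lambda>; finite E; E \<subseteq> Mor \<Lambda>; b \<in> Mor \<Lambda>\<rbrakk> \<Longrightarrow> finite (Ext b E)"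
  by (auto simp: Ext_def finitely_aligned_def)

lemma Ext_into: "\<lbrakk>b \<in> Mor \<Lambda>; E \<subseteq> Mor \<Lambda>\<rbrakk> \<Longrightarrow> Ext b E \<subseteq> into \<Lambda> (src \<Lambda> b)"
  by (auto simp: into_def elim!: mem_ExtE)

text \<open>For \<open>a\<close> with range \<open>src \<Lambda> b\<close>, the product
  \<open>ba\<close> and some \<open>e\<close> in \<open>E\<close> have a common extension
  \<open>t\<close>. It also lies above \<open>b\<close>, hence above some \<open>bp\<close> with
  \<open>p\<close> in \<open>Ext b E\<close>; cancelling \<open>b\<close> leaves a common extension
  of \<open>a\<close> and \<open>p\<close>.\<close>

lemma exhaustive_Ext:
  assumes "exhaustive \<Lambda> v E" "b \<in> into \<Lambda> v"
  shows "exhaustive \<Lambda> (src \<Lambda> b) (Ext b E)"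
  unfolding exhaustive_iff
proof (intro conjI ballI)
  have E: "E \<subseteq> Mor \<Lambda>" and b: "b \<in> Mor \<Lambda>"
    using assms by (auto simp: exhaustive_iff into_def)
  show "Ext b E \<subseteq> into \<Lambda> (src \<Lambda> b)" using Ext_into E b by blast
  fix a assume "a \<in> into \<Lambda> (src \<Lambda> b)"
  then have a: "a \<in> Mor \<Lambda>" "src \<Lambda> b = rng \<Lambda> a" by (auto simp: into_def)
  then have "cmp \<Lambda> b a \<in> into \<Lambda> v" using assms b by (auto simp: into_def cmp_closed rng_cmp)
  then obtain e t where et: "e \<in> E" "cmp \<Lambda> b a \<sqsubseteq> t" "e \<sqsubseteq> t"
    using assms by (auto simp: exhaustive_iff)
  have bt: "b \<sqsubseteq> t" using prefix_trans[OF prefix_ofI et(2)] a b by auto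
  obtain p where p: "p \<in> Ext b E" "cmp \<Lambda> b p \<sqsubseteq> t" by (rule Ext_below[OF bt et(3,1)])
  obtain t' where t': "t' \<in> Mor \<Lambda>" "src \<Lambda> b = rng \<Lambda> t'" "t = cmp \<Lambda> b t'"
    using bt by (elim prefix_ofE)
  have "p \<in> Mor \<Lambda>" "src \<Lambda> b = rng \<Lambda> p" using mem_ExtE[OF p(1) b E] by auto
  then show "\<exists>p\<in>Ext b E. \<exists>t. a \<sqsubseteq> t \<and> p \<sqsubseteq> t"
    using p et(2) t' a b by (auto simp: prefix_cmp_iff)
qed

section \<open>Paths and their initial segments\<close>

definition paths :: "('a, 'k) path set" where
  "paths = {x. snd x \<in> functors (Omega (pdeg x)) \<Lambda> \<and>
     (\<forall>a\<in>Mor (Omega (pdeg x)). deg \<Lambda> (snd x a) = deg (Omega (pdeg x)) a)}"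

lemma edeg_mono: "p \<le> q \<Longrightarrow> edeg p \<le> edeg q"
  by (simp add: edeg_def le_fun_def)

lemma edeg_le_trans: "\<lbrakk>p \<le> q; edeg q \<le> m\<rbrakk> \<Longrightarrow> edeg p \<le> m"
  using edeg_mono order_trans by blast

lemma edeg_0 [simp]: "edeg 0 \<le> m"
  by (simp add: edeg_def le_fun_def zero_enat_def[symmetric])

lemma deg_ge_0 [simp]: "0 \<le> (n :: 'k \<Rightarrow> nat)"
  by (simp add: le_fun_def)

lemma fun_diff_0 [simp]: "(n :: 'k \<Rightarrow> nat) - 0 = n" "n - n = 0"
  by (simp_all add: fun_eq_iff)

lemma mem_paths_iff:
  "x \<in> paths \<longleftrightarrow> snd x \<in> extensional (Mor (Omega (pdeg x))) \<and>
     (\<forall>p q. p \<le> q \<and> edeg q \<le> pdeg x \<longrightarrow> pmor x p q \<in> Mor \<Lambda> \<and>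
        rng \<Lambda> (pmor x p q) = pmor x p p \<and> src \<Lambda> (pmor x p q) = pmor x q q \<and>
        deg \<Lambda> (pmor x p q) = q - p) \<and>
     (\<forall>p q r. p \<le> q \<and> q \<le> r \<and> edeg r \<le> pdeg x \<longrightarrow>
        pmor x p r = cmp \<Lambda> (pmor x p q) (pmor x q r))"
  (is "_ \<longleftrightarrow> ?rhs")
proof -
  have Om: "(p, q) \<in> Mor (Omega m) \<longleftrightarrow> p \<le> q \<and> edeg q \<le> m"
    "rng (Omega m) (p, q) = (p, p)" "src (Omega m) (p, q) = (q, q)"
    "cmp (Omega m) (p, q) (p', q') = (p, q')" "deg (Omega m) (p, q) = q - p"
    for m :: "'k \<Rightarrow> enat" and p q p' q'
    by (simp_all add: Omega_def)
  have split: "(\<forall>a\<in>Mor (Omega m). P a) \<longleftrightarrow> (\<forall>p q. p \<le> q \<and> edeg q \<le> m \<longrightarrow> P (p, q))"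
    for m :: "'k \<Rightarrow> enat" and P
    unfolding Ball_def split_paired_All Om ..
  have "x \<in> paths \<longleftrightarrow> snd x \<in> extensional (Mor (Omega (pdeg x))) \<and>
     (\<forall>a\<in>Mor (Omega (pdeg x)). snd x a \<in> Mor \<Lambda>) \<and>
     (\<forall>a\<in>Mor (Omega (pdeg x)). rng \<Lambda> (snd x a) = snd x (rng (Omega (pdeg x)) a) \<and>
        src \<Lambda> (snd x a) = snd x (src (Omega (pdeg x)) a)) \<and>
     (\<forall>a\<in>Mor (Omega (pdeg x)). \<forall>b\<in>Mor (Omega (pdeg x)).
        src (Omega (pdeg x)) a = rng (Omega (pdeg x)) b \<longrightarrow>
        snd x (cmp (Omega (pdeg x)) a b) = cmp \<Lambda> (snd x a) (snd x b)) \<and>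
     (\<forall>a\<in>Mor (Omega (pdeg x)). deg \<Lambda> (snd x a) = deg (Omega (pdeg x)) a)"
    unfolding paths_def functors_def PiE_def Pi_def
    by (simp add: eq_commute[of "rng \<Lambda> _"] eq_commute[of "src \<Lambda> _" "snd x _"] Ball_def) blast
  also have "\<dots> \<longleftrightarrow> snd x \<in> extensional (Mor (Omega (pdeg x))) \<and>
     (\<forall>p q. p \<le> q \<and> edeg q \<le> pdeg x \<longrightarrow> pmor x p q \<in> Mor \<Lambda> \<and>
        rng \<Lambda> (pmor x p q) = pmor x p p \<and> src \<Lambda> (pmor x p q) = pmor x q q \<and>
        deg \<Lambda> (pmor x p q) = q - p) \<and>
     (\<forall>p q. p \<le> q \<and> edeg q \<le> pdeg x \<longrightarrow> (\<forall>q' r. q' \<le> r \<and> edeg r \<le> pdeg x \<longrightarrow>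
        (q, q) = (q', q') \<longrightarrow> pmor x p r = cmp \<Lambda> (pmor x p q) (pmor x q' r)))"
    unfolding split Om by (simp only: imp_conjR all_conj_distrib conj_ac)
  also have "\<dots> \<longleftrightarrow> ?rhs"
  proof (intro conj_cong refl iffI allI impI)
    fix p q r assume
      H: "\<forall>p q. p \<le> q \<and> edeg q \<le> pdeg x \<longrightarrow> (\<forall>q' r. q' \<le> r \<and> edeg r \<le> pdeg x \<longrightarrow>
        (q, q) = (q', q') \<longrightarrow> pmor x p r = cmp \<Lambda> (pmor x p q) (pmor x q' r))"
      and pqr: "p \<le> q \<and> q \<le> r \<and> edeg r \<le> pdeg x"
    then have "edeg q \<le> pdeg x" using edeg_le_trans by blast
    with pqr show "pmor x p r = cmp \<Lambda> (pmor x p q) (pmor x q r)"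
      using H[rule_format, of p q q r] by blast
  next
    fix p q q' r assume
      H: "\<forall>p q r. p \<le> q \<and> q \<le> r \<and> edeg r \<le> pdeg x \<longrightarrow>
        pmor x p r = cmp \<Lambda> (pmor x p q) (pmor x q r)"
      and "p \<le> q \<and> edeg q \<le> pdeg x" "q' \<le> r \<and> edeg r \<le> pdeg x" "(q, q) = (q', q')"
    then show "pmor x p r = cmp \<Lambda> (pmor x p q) (pmor x q' r)"
      using H[rule_format, of p q r] by blast
  qed
  finally show ?thesis .
qed

context
  fixes x assumes x: "x \<in> paths"
begin

lemma pmor_Mor: "\<lbrakk>p \<le> q; edeg q \<le> pdeg x\<rbrakk> \<Longrightarrow> pmor x p q \<in> Mor \<Lambda>"
  and rng_pmor: "\<lbrakk>p \<le> q; edeg q \<le> pdeg x\<rbrakk> \<Longrightarrow> rng \<Lambda> (pmor x p q) = pmor x p p"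
  and src_pmor: "\<lbrakk>p \<le> q; edeg q \<le> pdeg x\<rbrakk> \<Longrightarrow> src \<Lambda> (pmor x p q) = pmor x q q"
  and deg_pmor: "\<lbrakk>p \<le> q; edeg q \<le> pdeg x\<rbrakk> \<Longrightarrow> deg \<Lambda> (pmor x p q) = q - p"
  and pmor_cmp: "\<lbrakk>p \<le> q; q \<le> r; edeg r \<le> pdeg x\<rbrakk> \<Longrightarrow>
     pmor x p r = cmp \<Lambda> (pmor x p q) (pmor x q r)"
  using x unfolding mem_paths_iff by blast+

end

definition initseg :: "('a, 'k) path \<Rightarrow> 'a \<Rightarrow> bool" where
  "initseg x a \<longleftrightarrow> edeg (deg \<Lambda> a) \<le> pdeg x \<and> pmor x 0 (deg \<Lambda> a) = a"

lemma initseg_pmor: "\<lbrakk>x \<in> paths; edeg n \<le> pdeg x\<rbrakk> \<Longrightarrow> initseg x (pmor x 0 n)"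
  by (simp add: initseg_def deg_pmor)

lemma initseg_Mor: "\<lbrakk>x \<in> paths; initseg x a\<rbrakk> \<Longrightarrow> a \<in> Mor \<Lambda>"
  using pmor_Mor[of x 0 "deg \<Lambda> a"] by (simp add: initseg_def)

lemma initseg_src: "\<lbrakk>x \<in> paths; initseg x a\<rbrakk> \<Longrightarrow> src \<Lambda> a = pmor x (deg \<Lambda> a) (deg \<Lambda> a)"
  using src_pmor[of x 0 "deg \<Lambda> a"] by (simp add: initseg_def)

lemma pmor_prefix:
  "\<lbrakk>x \<in> paths; p \<le> q; edeg q \<le> pdeg x\<rbrakk> \<Longrightarrow> pmor x 0 p \<sqsubseteq> pmor x 0 q"
  using pmor_cmp[of x 0 p q] edeg_le_trans[of p q]
  by (simp add: prefix_ofI pmor_Mor src_pmor rng_pmor)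

lemma initseg_prefix:
  assumes "x \<in> paths" "initseg x b" "a \<sqsubseteq> b"
  shows "initseg x a"
proof -
  have *: "deg \<Lambda> a \<le> deg \<Lambda> b" "edeg (deg \<Lambda> b) \<le> pdeg x"
    using assms prefix_deg_le by (auto simp: initseg_def)
  then have **: "edeg (deg \<Lambda> a) \<le> pdeg x" using edeg_le_trans by blast
  have "pmor x 0 (deg \<Lambda> a) \<sqsubseteq> b"
    using pmor_prefix[OF assms(1) *] assms(2) by (simp add: initseg_def)
  then have "pmor x 0 (deg \<Lambda> a) = a"
    using assms(1,3) ** by (intro prefix_unique[of _ b]) (auto simp: deg_pmor)
  then show ?thesis using ** by (simp add: initseg_def)
qed

lemma initseg_directed:
  assumes "x \<in> paths" "initseg x a" "initseg x b"
  obtains c where "initseg x c" "a \<sqsubseteq> c" "b \<sqsubseteq> c"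
proof -
  let ?n = "sup (deg \<Lambda> a) (deg \<Lambda> b)"
  have "edeg ?n \<le> pdeg x"
    using assms(2,3) by (auto simp: initseg_def edeg_def le_fun_def sup_nat_def max_def)
  then have "initseg x (pmor x 0 ?n)" "pmor x 0 (deg \<Lambda> a) \<sqsubseteq> pmor x 0 ?n"
      "pmor x 0 (deg \<Lambda> b) \<sqsubseteq> pmor x 0 ?n"
    using assms(1) by (auto intro!: initseg_pmor pmor_prefix)
  then show thesis using assms(2,3) that by (auto simp: initseg_def)
qed

lemma initseg_rng: "\<lbrakk>x \<in> paths; initseg x a\<rbrakk> \<Longrightarrow> rng \<Lambda> a = pmor x 0 0"
  using rng_pmor[of x 0 "deg \<Lambda> a"] by (simp add: initseg_def)

lemma initseg_range: "x \<in> paths \<Longrightarrow> initseg x (pmor x 0 0)"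
  by (simp add: initseg_pmor)

text \<open>Since \<open>x(0, n + d(a))\<close> is the product of \<open>x(0, n)\<close> and
  \<open>x(n, n + d(a))\<close>, left cancellation lets an initial segment detect a segment in the
  interior of \<open>x\<close>.\<close>

lemma initseg_cmp_iff:
  assumes "x \<in> paths" "edeg n \<le> pdeg x" "a \<in> Mor \<Lambda>" "rng \<Lambda> a = pmor x n n"
  shows "initseg x (cmp \<Lambda> (pmor x 0 n) a) \<longleftrightarrow>
    edeg (n + deg \<Lambda> a) \<le> pdeg x \<and> pmor x n (n + deg \<Lambda> a) = a"
proof -
  have 0: "pmor x 0 n \<in> Mor \<Lambda>" "src \<Lambda> (pmor x 0 n) = rng \<Lambda> a" "deg \<Lambda> (pmor x 0 n) = n"
    using assms by (auto simp: pmor_Mor src_pmor deg_pmor)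
  then have d: "deg \<Lambda> (cmp \<Lambda> (pmor x 0 n) a) = n + deg \<Lambda> a"
    using assms by (simp add: deg_cmp)
  have le: "n \<le> n + deg \<Lambda> a" by (simp add: le_fun_def)
  have "pmor x 0 (n + deg \<Lambda> a) = cmp \<Lambda> (pmor x 0 n) a \<longleftrightarrow> pmor x n (n + deg \<Lambda> a) = a"
    if e: "edeg (n + deg \<Lambda> a) \<le> pdeg x"
    using pmor_cmp[OF assms(1) _ le e, of 0] 0 assms le e
    by (auto intro: cmp_left_cancel[of "pmor x 0 n"] simp: pmor_Mor rng_pmor src_pmor)
  then show ?thesis unfolding initseg_def d by blast
qed

section \<open>Paths as directed downward closed sets of morphisms\<close>

lemma enat_leI: "a \<le> b" if "\<And>j. enat j \<le> a \<Longrightarrow> enat j \<le> b" for a b :: enat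
proof (cases a)
  case infinity
  show ?thesis
  proof (cases b)
    case (enat m)
    then show ?thesis using that[of "Suc m"] infinity by simp
  qed simp
qed (use that in simp)

text \<open>The degree is recovered from the degrees of the initial segments, and
  \<open>x(p, q)\<close> by cancelling \<open>x(0, p)\<close> from \<open>x(0, q)\<close>.\<close>

lemma paths_eqI:
  assumes x: "x \<in> paths" and y: "y \<in> paths" and eq: "\<And>a. initseg x a \<longleftrightarrow> initseg y a"
  shows "x = y"
proof -
  have *: "edeg n \<le> pdeg v \<longleftrightarrow> (\<exists>a. initseg v a \<and> deg \<Lambda> a = n)" if "v \<in> paths" for v n
    using that by (auto simp: initseg_def deg_pmor intro!: exI[of _ "pmor v 0 n"])
  have le: "edeg n \<le> pdeg x \<longleftrightarrow> edeg n \<le> pdeg y" for n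
    using *[OF x] *[OF y] eq by auto
  have E: "enat j \<le> pdeg x i \<longleftrightarrow> enat j \<le> pdeg y i" for i j
  proof -
    \<comment> \<open>The degree with \<open>j\<close> at coordinate \<open>i\<close> and
      \<open>0\<close> elsewhere isolates that coordinate of the possibly infinite degree.\<close>
    have "edeg (\<lambda>l. if l = i then j else 0) \<le> m \<longleftrightarrow> enat j \<le> m i" for m :: "'k \<Rightarrow> enat"
      by (auto simp: edeg_def le_fun_def zero_enat_def[symmetric])
    then show ?thesis using le[of "\<lambda>l. if l = i then j else 0"] by simp
  qed
  have "pdeg x i = pdeg y i" for i by (rule order_antisym; rule enat_leI) (simp_all add: E)
  then have d: "pdeg x = pdeg y" by (rule ext)
  have i: "pmor x 0 n = pmor y 0 n" if "edeg n \<le> pdeg x" for n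
  proof -
    have "initseg y (pmor x 0 n)" using initseg_pmor[OF x that] by (simp only: eq[symmetric])
    then show ?thesis using deg_pmor[OF x _ that, of 0] by (simp add: initseg_def)
  qed
  have "pmor x p q = pmor y p q" if pq: "p \<le> q" "edeg q \<le> pdeg x" for p q
  proof -
    have p: "edeg p \<le> pdeg x" using pq edeg_le_trans by blast
    have "cmp \<Lambda> (pmor x 0 p) (pmor x p q) = pmor y 0 q"
      using pmor_cmp[OF x _ pq, of 0] i[OF pq(2)] by simp
    also have "\<dots> = cmp \<Lambda> (pmor x 0 p) (pmor y p q)"
      using pmor_cmp[OF y _ pq(1), of 0] pq(2) i[OF p] d by simp
    finally show ?thesis
    proof (rule cmp_left_cancel[rotated 5])
      show "src \<Lambda> (pmor x 0 p) = rng \<Lambda> (pmor y p q)"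
        using i[OF p] y p pq d by (simp add: src_pmor rng_pmor)
    qed (use x y p pq d in \<open>simp_all add: pmor_Mor src_pmor rng_pmor\<close>)
  qed
  then have "snd x a = snd y a" if "a \<in> Mor (Omega (pdeg x))" for a
    using that by (auto simp: Omega_def)
  then have "snd x = snd y"
    using x y d by (intro extensionalityI[of _ "Mor (Omega (pdeg x))"]) (auto simp: mem_paths_iff)
  with d show ?thesis by (simp add: prod_eq_iff)
qed

text \<open>The degree of the path is the coordinatewise supremum \<open>m\<close>, possibly
  infinite, of the degrees in \<open>S\<close>. For \<open>n\<close> below \<open>m\<close> there is
  exactly one member \<open>f n\<close> of \<open>S\<close> of degree \<open>n\<close>, and
  \<open>x(p, q)\<close> is the unique \<open>g (p, q)\<close> that completes \<open>f p\<close> to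
  \<open>f q\<close>. Its uniqueness yields the identities and the composition law.\<close>

lemma path_of_ideal:
  assumes S: "S \<subseteq> Mor \<Lambda>" "S \<noteq> {}"
    and directed: "\<And>a b. \<lbrakk>a \<in> S; b \<in> S\<rbrakk> \<Longrightarrow> \<exists>c\<in>S. a \<sqsubseteq> c \<and> b \<sqsubseteq> c"
    and down: "\<And>a b. \<lbrakk>b \<in> S; a \<sqsubseteq> b\<rbrakk> \<Longrightarrow> a \<in> S"
  shows "\<exists>x\<in>paths. \<forall>a. initseg x a \<longleftrightarrow> a \<in> S"
proof -
  define m where "m = (\<lambda>i. SUP a\<in>S. enat (deg \<Lambda> a i))"
  have f_ex: "\<exists>a\<in>S. deg \<Lambda> a = n" if n: "edeg n \<le> m" for n
  proof -
    have 1: "\<exists>a\<in>S. n i \<le> deg \<Lambda> a i" for i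
    proof (rule ccontr)
      assume "\<not> ?thesis"
      then have *: "\<And>a. a \<in> S \<Longrightarrow> deg \<Lambda> a i < n i" by (meson not_le)
      \<comment> \<open>If no degree reached \<open>n i\<close>, the supremum would be at most
        \<open>n i - 1\<close>. As \<open>S\<close> is nonempty, \<open>n i\<close> is then
        positive, so the truncated subtraction really decreases it.\<close>
      then have "m i \<le> enat (n i - 1)" unfolding m_def by (intro SUP_least) force
      moreover have "n i > 0" using * S(2) by (metis ex_in_conv gr_implies_not0 gr0I)
      moreover have "enat (n i) \<le> m i" using n by (simp add: edeg_def le_fun_def)
      ultimately have "enat (n i) \<le> enat (n i - 1)" using order_trans by blast
      with \<open>n i > 0\<close> show False by simp
    qed
    \<comment> \<open>Different coordinates may be reached by different members of \<open>S\<close>;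
      directedness merges them, one coordinate of the finite type \<open>'k\<close> at a
      time.\<close>
    have "\<exists>a\<in>S. \<forall>i\<in>I. n i \<le> deg \<Lambda> a i" if "finite I" for I
      using that
    proof induction
      case empty
      then show ?case using S(2) by auto
    next
      case (insert i I)
      obtain a b where "a \<in> S" "n i \<le> deg \<Lambda> a i" "b \<in> S" "\<forall>i\<in>I. n i \<le> deg \<Lambda> b i"
        using insert.IH 1 by blast
      moreover obtain c where "c \<in> S" "a \<sqsubseteq> c" "b \<sqsubseteq> c" using directed calculation by blast
      moreover have "deg \<Lambda> a \<le> deg \<Lambda> c" "deg \<Lambda> b \<le> deg \<Lambda> c"
        using calculation prefix_deg_le by auto
      ultimately show ?case by (intro bexI[of _ c]) (auto simp: le_fun_def intro: order_trans)
    qed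
    from this[of UNIV] obtain a where "a \<in> S" "n \<le> deg \<Lambda> a" by (auto simp: le_fun_def)
    then show ?thesis using prefix_exists[of a n] S(1) down by blast
  qed
  then obtain f where f: "\<And>n. edeg n \<le> m \<Longrightarrow> f n \<in> S \<and> deg \<Lambda> (f n) = n"
    by metis
  have uniq: "a = b" if "a \<in> S" "b \<in> S" "deg \<Lambda> a = deg \<Lambda> b" for a b
    using directed[OF that(1,2)] prefix_unique that(3) by blast
  have f_mono: "f p \<sqsubseteq> f q" if pq: "p \<le> q" "edeg q \<le> m" for p q
  proof -
    have "edeg p \<le> m" using pq edeg_le_trans by blast
    note fp = f[OF this] and fq = f[OF pq(2)]
    obtain c where "f p \<sqsubseteq> c" "f q \<sqsubseteq> c" using directed fp fq by blast
    then show ?thesis by (rule prefix_chain) (use fp fq pq in simp)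
  qed
  have f_Mor: "f p \<in> Mor \<Lambda>" if "edeg p \<le> m" for p using f[OF that] S(1) by blast
  define g where "g = (\<lambda>(p, q). SOME c. c \<in> Mor \<Lambda> \<and> src \<Lambda> (f p) = rng \<Lambda> c \<and> f q = cmp \<Lambda> (f p) c)"
  have "g (p, q) \<in> Mor \<Lambda> \<and> src \<Lambda> (f p) = rng \<Lambda> (g (p, q)) \<and> f q = cmp \<Lambda> (f p) (g (p, q))"
    if pq: "p \<le> q" "edeg q \<le> m" for p q
  proof -
    have "\<exists>c. c \<in> Mor \<Lambda> \<and> src \<Lambda> (f p) = rng \<Lambda> c \<and> f q = cmp \<Lambda> (f p) c"
      using f_mono[OF pq] by (auto simp: prefix_of_def)
    from someI_ex[OF this] show ?thesis by (simp add: g_def)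
  qed
  then have g_Mor: "\<And>p q. \<lbrakk>p \<le> q; edeg q \<le> m\<rbrakk> \<Longrightarrow> g (p, q) \<in> Mor \<Lambda>"
    and g_rng: "\<And>p q. \<lbrakk>p \<le> q; edeg q \<le> m\<rbrakk> \<Longrightarrow> rng \<Lambda> (g (p, q)) = src \<Lambda> (f p)"
    and g_cmp: "\<And>p q. \<lbrakk>p \<le> q; edeg q \<le> m\<rbrakk> \<Longrightarrow> cmp \<Lambda> (f p) (g (p, q)) = f q"
    by (metis, metis, metis)
  have g_unique: "g (p, q) = c"
    if pq: "p \<le> q" "edeg q \<le> m" and c: "c \<in> Mor \<Lambda>" "rng \<Lambda> c = src \<Lambda> (f p)" "cmp \<Lambda> (f p) c = f q"
    for p q c
  proof -
    have "edeg p \<le> m" using pq edeg_le_trans by blast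
    note p = f_Mor[OF this]
    show ?thesis
      by (rule cmp_left_cancel[of "f p"]) (simp_all add: p g_Mor g_rng g_cmp pq c)
  qed
  have g_id: "g (p, p) = src \<Lambda> (f p)" if "edeg p \<le> m" for p
    by (rule g_unique) (use that f_Mor[OF that] in \<open>simp_all add: src_closed rng_src cmp_src\<close>)
  have g_src: "src \<Lambda> (g (p, q)) = src \<Lambda> (f q)" if pq: "p \<le> q" "edeg q \<le> m" for p q
  proof -
    have p: "edeg p \<le> m" using pq edeg_le_trans by blast
    have "src \<Lambda> (cmp \<Lambda> (f p) (g (p, q))) = src \<Lambda> (g (p, q))"
      by (rule src_cmp) (simp_all add: p f_Mor g_Mor g_rng pq)
    then show ?thesis by (simp add: g_cmp pq)
  qed
  have g_deg: "deg \<Lambda> (g (p, q)) = q - p" if pq: "p \<le> q" "edeg q \<le> m" for p q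
  proof -
    have p: "edeg p \<le> m" using pq edeg_le_trans by blast
    have "deg \<Lambda> (cmp \<Lambda> (f p) (g (p, q))) = deg \<Lambda> (f p) + deg \<Lambda> (g (p, q))"
      by (rule deg_cmp) (simp_all add: p f_Mor g_Mor g_rng pq)
    then have "q = p + deg \<Lambda> (g (p, q))" using f[OF p] f[OF pq(2)] by (simp add: g_cmp pq)
    then show ?thesis by (metis add_diff_cancel_left')
  qed
  have g_comp: "g (p, r) = cmp \<Lambda> (g (p, q)) (g (q, r))"
    if pqr: "p \<le> q" "q \<le> r" "edeg r \<le> m" for p q r
  proof -
    have q: "edeg q \<le> m" using pqr edeg_le_trans by blast
    then have p: "edeg p \<le> m" using pqr edeg_le_trans by blast
    show ?thesis
    proof (rule g_unique)
      have "cmp \<Lambda> (f p) (cmp \<Lambda> (g (p, q)) (g (q, r))) = cmp \<Lambda> (cmp \<Lambda> (f p) (g (p, q))) (g (q, r))"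
        by (rule cmp_assoc[symmetric]) (simp_all add: f_Mor g_Mor g_rng g_src p q pqr)
      then show "cmp \<Lambda> (f p) (cmp \<Lambda> (g (p, q)) (g (q, r))) = f r"
        by (simp add: g_cmp p q pqr)
    qed (use p q pqr in \<open>auto simp: cmp_closed g_Mor g_rng g_src rng_cmp\<close>)
  qed
  define x where "x = (m, restrict g (Mor (Omega m)))"
  have pdeg: "pdeg x = m" by (simp add: x_def)
  have pmor: "pmor x p q = g (p, q)" if "p \<le> q" "edeg q \<le> m" for p q
    using that by (simp add: x_def Omega_def)
  have path: "x \<in> paths"
    unfolding mem_paths_iff pdeg
  proof (intro conjI allI impI)
    fix p q r assume "p \<le> q \<and> q \<le> r \<and> edeg r \<le> m"
    then have pqr: "p \<le> q" "q \<le> r" "edeg r \<le> m" by auto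
    moreover have "edeg q \<le> m" using pqr edeg_le_trans by blast
    moreover have "p \<le> r" using pqr by simp
    ultimately show "pmor x p r = cmp \<Lambda> (pmor x p q) (pmor x q r)"
      using g_comp[of p q r] by (simp add: pmor)
  next
    fix p q assume "p \<le> q \<and> edeg q \<le> m"
    then have pq: "p \<le> q" "edeg q \<le> m" by auto
    moreover have "edeg p \<le> m" using pq edeg_le_trans by blast
    ultimately show "pmor x p q \<in> Mor \<Lambda>" "rng \<Lambda> (pmor x p q) = pmor x p p"
      "src \<Lambda> (pmor x p q) = pmor x q q" "deg \<Lambda> (pmor x p q) = q - p"
      by (simp_all add: pmor g_Mor g_rng g_src g_id g_deg)
  qed (simp add: x_def)
  have pm0: "pmor x 0 n = f n" if n: "edeg n \<le> m" for n
  proof -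
    \<comment> \<open>\<open>f 0\<close> has degree \<open>0\<close> and is therefore an identity,
      so the cofactor \<open>g (0, n)\<close> is all of \<open>f n\<close>.\<close>
    have f0: "f 0 \<in> Obj \<Lambda>" using f[of 0] f_Mor[of 0] by (simp add: deg_0_Obj)
    have "f n = cmp \<Lambda> (f 0) (g (0, n))" using n by (simp add: g_cmp)
    also have "f 0 = rng \<Lambda> (g (0, n))" using n g_rng[of 0 n] Obj_src[OF f0] by simp
    also have "cmp \<Lambda> \<dots> (g (0, n)) = g (0, n)" using n by (simp add: cmp_rng g_Mor)
    finally show ?thesis using n by (simp add: pmor)
  qed
  have "initseg x a \<longleftrightarrow> a \<in> S" for a
  proof
    assume "initseg x a"
    then have "edeg (deg \<Lambda> a) \<le> m" "f (deg \<Lambda> a) = a"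
      using pm0 by (auto simp: initseg_def pdeg)
    then show "a \<in> S" using f by metis
  next
    assume a: "a \<in> S"
    then have *: "edeg (deg \<Lambda> a) \<le> m"
      by (auto simp: edeg_def le_fun_def m_def intro!: SUP_upper)
    then have "f (deg \<Lambda> a) = a" using uniq f a by blast
    then show "initseg x a" using * pm0 by (simp add: initseg_def pdeg)
  qed
  with path show ?thesis by blast
qed

section \<open>Boundary paths\<close>

lemma FE_into: "\<lbrakk>E \<in> FE \<Lambda> v; e \<in> E\<rbrakk> \<Longrightarrow> e \<in> Mor \<Lambda> \<and> rng \<Lambda> e = v"
  by (auto simp: FE_def into_def)

text \<open>The point \<open>n\<close> is encoded by the segment \<open>a = x(0, n)\<close>, whose
  source is \<open>x(n)\<close>; \<open>initseg_cmp_iff\<close> turns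
  \<open>x(n, n + d(e)) = e\<close> into \<open>ae\<close> being an initial segment.\<close>

lemma boundary_iff:
  "x \<in> boundary_paths \<Lambda> \<longleftrightarrow> x \<in> paths \<and>
     (\<forall>a. initseg x a \<longrightarrow> (\<forall>E\<in>FE \<Lambda> (src \<Lambda> a). \<exists>e\<in>E. initseg x (cmp \<Lambda> a e)))"
proof (cases "x \<in> paths")
  case x: True
  have *: "initseg x (cmp \<Lambda> (pmor x 0 n) e) \<longleftrightarrow>
      edeg (n + deg \<Lambda> e) \<le> pdeg x \<and> pmor x n (n + deg \<Lambda> e) = e"
    if "edeg n \<le> pdeg x" "E \<in> FE \<Lambda> (pmor x n n)" "e \<in> E" for n E e
    using initseg_cmp_iff[OF x that(1)] FE_into[OF that(2,3)] by blast
  have "x \<in> boundary_paths \<Lambda> \<longleftrightarrow> (\<forall>n. edeg n \<le> pdeg x \<longrightarrow>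
      (\<forall>E\<in>FE \<Lambda> (pmor x n n). \<exists>e\<in>E. initseg x (cmp \<Lambda> (pmor x 0 n) e)))"
    using x unfolding boundary_paths_def paths_def mem_Collect_eq by (simp add: * cong: ball_cong bex_cong)
  also have "\<dots> \<longleftrightarrow> (\<forall>a. initseg x a \<longrightarrow> (\<forall>E\<in>FE \<Lambda> (src \<Lambda> a). \<exists>e\<in>E. initseg x (cmp \<Lambda> a e)))"
  proof (intro iffI allI impI)
    fix a assume H: "\<forall>n. edeg n \<le> pdeg x \<longrightarrow>
      (\<forall>E\<in>FE \<Lambda> (pmor x n n). \<exists>e\<in>E. initseg x (cmp \<Lambda> (pmor x 0 n) e))" and a: "initseg x a"
    then show "\<forall>E\<in>FE \<Lambda> (src \<Lambda> a). \<exists>e\<in>E. initseg x (cmp \<Lambda> a e)"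
      using H[rule_format, of "deg \<Lambda> a"] initseg_src[OF x a] a by (simp add: initseg_def)
  next
    fix n assume H: "\<forall>a. initseg x a \<longrightarrow> (\<forall>E\<in>FE \<Lambda> (src \<Lambda> a). \<exists>e\<in>E. initseg x (cmp \<Lambda> a e))"
      and n: "edeg n \<le> pdeg x"
    then show "\<forall>E\<in>FE \<Lambda> (pmor x n n). \<exists>e\<in>E. initseg x (cmp \<Lambda> (pmor x 0 n) e)"
      using H[rule_format, OF initseg_pmor[OF x n]] x by (simp add: src_pmor)
  qed
  finally show ?thesis using x by blast
qed (auto simp: boundary_paths_def paths_def)

lemma boundary_paths_path: "x \<in> boundary_paths \<Lambda> \<Longrightarrow> x \<in> paths"
  by (simp add: boundary_iff)

text \<open>\<open>FE\<close> excludes sets containing the vertex itself, but these are met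
  trivially with \<open>e = src \<Lambda> a\<close>. The extension to all finite exhaustive sets
  matters because sets of the form \<open>Ext b E\<close> may contain the vertex.\<close>

lemma boundary_exhaustive:
  assumes x: "x \<in> boundary_paths \<Lambda>" and a: "initseg x a"
    and E: "finite E" "exhaustive \<Lambda> (src \<Lambda> a) E"
  obtains e where "e \<in> E" "initseg x (cmp \<Lambda> a e)"
proof (cases "src \<Lambda> a \<in> E")
  case True
  moreover have "a \<in> Mor \<Lambda>" using x a boundary_paths_path initseg_Mor by blast
  ultimately show thesis using that[of "src \<Lambda> a"] a by (simp add: cmp_src)
next
  case False
  moreover have "a \<in> Mor \<Lambda>" using x a boundary_paths_path initseg_Mor by blast
  ultimately have "E \<in> FE \<Lambda> (src \<Lambda> a)"
    using E src_Obj by (auto simp: FE_def exhaustive_def)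
  then show thesis using x a that by (auto simp: boundary_iff)
qed

section \<open>Shifts and concatenations\<close>

context
  fixes x a assumes x: "x \<in> paths" and a: "initseg x a"
begin

lemma pdeg_shift: "edeg q \<le> pdeg (shift (deg \<Lambda> a) x) \<longleftrightarrow> edeg (deg \<Lambda> a + q) \<le> pdeg x"
proof -
  have "enat (q i) \<le> pdeg x i - enat (deg \<Lambda> a i) \<longleftrightarrow> enat (deg \<Lambda> a i + q i) \<le> pdeg x i" for i
  proof -
    \<comment> \<open>Subtraction on \<open>enat\<close> is truncated; it is exact here because
      \<open>a\<close> is an initial segment of \<open>x\<close>.\<close>
    have "enat (deg \<Lambda> a i) \<le> pdeg x i"
      using a by (simp add: initseg_def edeg_def le_fun_def)
    then show ?thesis by (cases "pdeg x i") auto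
  qed
  then show ?thesis by (simp add: shift_def Let_def edeg_def le_fun_def)
qed

lemma pmor_shift:
  assumes "p \<le> q" "edeg (deg \<Lambda> a + q) \<le> pdeg x"
  shows "pmor (shift (deg \<Lambda> a) x) p q = pmor x (deg \<Lambda> a + p) (deg \<Lambda> a + q)"
proof -
  have "(p, q) \<in> Mor (Omega (pdeg (shift (deg \<Lambda> a) x)))"
    using assms pdeg_shift by (simp add: Omega_def)
  then show ?thesis by (simp add: shift_def Let_def)
qed

lemma shift_path: "shift (deg \<Lambda> a) x \<in> paths"
  unfolding mem_paths_iff pdeg_shift
proof (intro conjI allI impI)
  let ?n = "deg \<Lambda> a"
  have le: "?n + p \<le> ?n + q" if "p \<le> q" for p q using that by (simp add: le_fun_def)
  fix p q r assume "p \<le> q \<and> q \<le> r \<and> edeg (?n + r) \<le> pdeg x"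
  then have pqr: "p \<le> q" "q \<le> r" "edeg (?n + r) \<le> pdeg x" by auto
  moreover have "edeg (?n + q) \<le> pdeg x" using le pqr edeg_le_trans by blast
  moreover have "p \<le> r" using pqr by simp
  ultimately show "pmor (shift ?n x) p r = cmp \<Lambda> (pmor (shift ?n x) p q) (pmor (shift ?n x) q r)"
    using pmor_cmp[OF x le[OF pqr(1)] le[OF pqr(2)] pqr(3)] by (simp add: pmor_shift)
next
  let ?n = "deg \<Lambda> a"
  fix p q assume "p \<le> q \<and> edeg (?n + q) \<le> pdeg x"
  then have pq: "p \<le> q" "edeg (?n + q) \<le> pdeg x" by auto
  have le: "?n + p \<le> ?n + q" using pq by (simp add: le_fun_def)
  have "edeg (?n + p) \<le> pdeg x" using le pq edeg_le_trans by blast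
  then show "pmor (shift ?n x) p q \<in> Mor \<Lambda>"
     "rng \<Lambda> (pmor (shift ?n x) p q) = pmor (shift ?n x) p p"
     "src \<Lambda> (pmor (shift ?n x) p q) = pmor (shift ?n x) q q"
     "deg \<Lambda> (pmor (shift ?n x) p q) = q - p"
    using le pq x by (simp_all add: pmor_shift pmor_Mor src_pmor rng_pmor deg_pmor fun_eq_iff)
qed (simp add: shift_def Let_def)

lemma initseg_shift:
  "initseg (shift (deg \<Lambda> a) x) b \<longleftrightarrow> b \<in> Mor \<Lambda> \<and> rng \<Lambda> b = src \<Lambda> a \<and> initseg x (cmp \<Lambda> a b)"
proof -
  let ?n = "deg \<Lambda> a" and ?y = "shift (deg \<Lambda> a) x"
  have n: "edeg ?n \<le> pdeg x" "pmor x 0 ?n = a" using a by (auto simp: initseg_def)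
  have src: "src \<Lambda> a = pmor x ?n ?n" using initseg_src x a by blast
  have "rng \<Lambda> b = src \<Lambda> a" if "initseg ?y b"
    using initseg_rng[OF shift_path that] src n(1) pmor_shift[of 0 0] by simp
  moreover have "b \<in> Mor \<Lambda>" if "initseg ?y b" using initseg_Mor[OF shift_path that] .
  moreover have "initseg ?y b \<longleftrightarrow> initseg x (cmp \<Lambda> a b)" if "b \<in> Mor \<Lambda>" "rng \<Lambda> b = src \<Lambda> a"
    using initseg_cmp_iff[OF x n(1) that(1)] that(2) n(2) src pmor_shift[of 0 "deg \<Lambda> b"]
    by (auto simp: initseg_def[of ?y] pdeg_shift)
  ultimately show ?thesis by blast
qed

text \<open>By directedness every initial segment of \<open>x\<close> lies below one that extends
  \<open>a\<close>, hence below some \<open>ac\<close>. So \<open>x\<close> is determined by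
  \<open>a\<close> and its shift, and the right-hand side tells which set has to define a
  concatenation.\<close>

lemma initseg_via_shift:
  "initseg x b \<longleftrightarrow> (\<exists>c. initseg (shift (deg \<Lambda> a) x) c \<and> b \<sqsubseteq> cmp \<Lambda> a c)"
proof
  assume "initseg x b"
  then obtain d where d: "initseg x d" "a \<sqsubseteq> d" "b \<sqsubseteq> d" using initseg_directed x a by blast
  then obtain c where "c \<in> Mor \<Lambda>" "src \<Lambda> a = rng \<Lambda> c" "d = cmp \<Lambda> a c" by (auto simp: prefix_of_def)
  with d show "\<exists>c. initseg (shift (deg \<Lambda> a) x) c \<and> b \<sqsubseteq> cmp \<Lambda> a c"
    unfolding initseg_shift by metis
qed (use initseg_shift initseg_prefix[OF x] in blast)

lemma pmor_shift_0: "pmor (shift (deg \<Lambda> a) x) 0 0 = src \<Lambda> a"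
  using pmor_shift[of 0 0] initseg_src[OF x a] a by (simp add: initseg_def)

end

lemma shift_boundary:
  assumes x: "x \<in> boundary_paths \<Lambda>" and a: "initseg x a"
  shows "shift (deg \<Lambda> a) x \<in> boundary_paths_at \<Lambda> (src \<Lambda> a)"
proof -
  note xp = boundary_paths_path[OF x]
  have am: "a \<in> Mor \<Lambda>" using initseg_Mor xp a by blast
  have "shift (deg \<Lambda> a) x \<in> boundary_paths \<Lambda>"
    unfolding boundary_iff
  proof (intro conjI allI impI ballI)
    fix b E assume "initseg (shift (deg \<Lambda> a) x) b" and E: "E \<in> FE \<Lambda> (src \<Lambda> b)"
    then have b: "b \<in> Mor \<Lambda>" "rng \<Lambda> b = src \<Lambda> a" "initseg x (cmp \<Lambda> a b)"
      using initseg_shift[OF xp a] by auto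
    then have "src \<Lambda> (cmp \<Lambda> a b) = src \<Lambda> b" using am by (simp add: src_cmp)
    then obtain e where e: "e \<in> E" "initseg x (cmp \<Lambda> (cmp \<Lambda> a b) e)"
      using x b(3) E unfolding boundary_iff by metis
    have "e \<in> Mor \<Lambda>" "rng \<Lambda> e = src \<Lambda> b" using FE_into[OF E e(1)] by auto
    then have "initseg (shift (deg \<Lambda> a) x) (cmp \<Lambda> b e)"
      using e(2) b(1,2) am unfolding initseg_shift[OF xp a]
      by (simp add: cmp_assoc cmp_closed rng_cmp)
    then show "\<exists>e\<in>E. initseg (shift (deg \<Lambda> a) x) (cmp \<Lambda> b e)" using e(1) by blast
  qed (rule shift_path[OF xp a])
  then show ?thesis using pmor_shift_0[OF xp a] by (simp add: boundary_paths_at_def)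
qed

lemma boundary_paths_atD:
  "z \<in> boundary_paths_at \<Lambda> v \<Longrightarrow> z \<in> boundary_paths \<Lambda>"
  "z \<in> boundary_paths_at \<Lambda> v \<Longrightarrow> pmor z 0 0 = v"
  by (auto simp: boundary_paths_at_def)

text \<open>The path comes from the downward closure of the products \<open>ac\<close> with
  \<open>c\<close> an initial segment of \<open>z\<close>. The boundary condition is the delicate
  point, since an initial segment \<open>b\<close> of the result need not be comparable with
  \<open>a\<close>.\<close>

lemma prepend_boundary_path:
  assumes fa: "finitely_aligned \<Lambda>" and a: "a \<in> Mor \<Lambda>"
    and z: "z \<in> boundary_paths_at \<Lambda> (src \<Lambda> a)"
  obtains y where "y \<in> boundary_paths \<Lambda>" "initseg y a" "shift (deg \<Lambda> a) y = z"
proof -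
  note zb = boundary_paths_atD(1)[OF z]
  note zp = boundary_paths_path[OF zb]
  have zc: "c \<in> Mor \<Lambda>" "rng \<Lambda> c = src \<Lambda> a" if "initseg z c" for c
    using initseg_Mor[OF zp that] initseg_rng[OF zp that] boundary_paths_atD(2)[OF z] by auto
  have z0: "initseg z (src \<Lambda> a)" using initseg_range[OF zp] boundary_paths_atD(2)[OF z] by simp
  define S where "S = {b. \<exists>c. initseg z c \<and> b \<sqsubseteq> cmp \<Lambda> a c}"
  have "\<exists>y\<in>paths. \<forall>b. initseg y b \<longleftrightarrow> b \<in> S"
  proof (rule path_of_ideal)
    show "S \<subseteq> Mor \<Lambda>" using prefix_Mor(1) by (auto simp: S_def)
    have "a \<sqsubseteq> cmp \<Lambda> a (src \<Lambda> a)" using a by (simp add: cmp_src prefix_refl)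
    then show "S \<noteq> {}" using z0 by (auto simp: S_def)
  next
    fix b b' assume "b \<in> S" "b' \<in> S"
    then obtain c c' where c: "initseg z c" "b \<sqsubseteq> cmp \<Lambda> a c" "initseg z c'" "b' \<sqsubseteq> cmp \<Lambda> a c'"
      by (auto simp: S_def)
    obtain d where d: "initseg z d" "c \<sqsubseteq> d" "c' \<sqsubseteq> d" by (rule initseg_directed[OF zp c(1,3)])
    have "cmp \<Lambda> a c \<sqsubseteq> cmp \<Lambda> a d" "cmp \<Lambda> a c' \<sqsubseteq> cmp \<Lambda> a d"
      using prefix_cmp_iff[OF a] zc c(1,3) d by simp_all
    then have "b \<sqsubseteq> cmp \<Lambda> a d" "b' \<sqsubseteq> cmp \<Lambda> a d" using c prefix_trans by blast+
    moreover have "cmp \<Lambda> a d \<in> S"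
      using d(1) prefix_refl[OF prefix_Mor(2)[OF \<open>b \<sqsubseteq> cmp \<Lambda> a d\<close>]] by (auto simp: S_def)
    ultimately show "\<exists>c\<in>S. b \<sqsubseteq> c \<and> b' \<sqsubseteq> c" by blast
  next
    fix b b' assume "b \<in> S" "b' \<sqsubseteq> b"
    then show "b' \<in> S" unfolding S_def using prefix_trans by blast
  qed
  then obtain y where y: "y \<in> paths" and yS: "\<And>b. initseg y b \<longleftrightarrow> b \<in> S" by blast
  have ya: "initseg y a"
    using z0 a by (auto simp: yS S_def cmp_src prefix_refl intro!: exI[of _ "src \<Lambda> a"])
  have sh: "shift (deg \<Lambda> a) y = z"
  proof (rule paths_eqI[OF shift_path[OF y ya] zp])
    fix c
    show "initseg (shift (deg \<Lambda> a) y) c \<longleftrightarrow> initseg z c"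
    proof
      assume "initseg (shift (deg \<Lambda> a) y) c"
      then obtain c' where c: "c \<in> Mor \<Lambda>" "rng \<Lambda> c = src \<Lambda> a"
        and c': "initseg z c'" "cmp \<Lambda> a c \<sqsubseteq> cmp \<Lambda> a c'"
        unfolding initseg_shift[OF y ya] yS S_def by blast
      have "c \<sqsubseteq> c'" 
        using prefix_cmp_iff[OF a c(1) zc(1) c(2)[symmetric] zc(2)[symmetric]] c' by blast
      then show "initseg z c" by (rule initseg_prefix[OF zp c'(1)])
    next
      assume c: "initseg z c"
      then have "cmp \<Lambda> a c \<sqsubseteq> cmp \<Lambda> a c"
        using zc a by (intro prefix_refl cmp_closed) auto
      then show "initseg (shift (deg \<Lambda> a) y) c"
        using zc[OF c] c unfolding initseg_shift[OF y ya] yS S_def by blast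
    qed
  qed
  have "y \<in> boundary_paths \<Lambda>"
    unfolding boundary_iff
  proof (intro conjI allI impI ballI)
    fix b E assume "initseg y b" and E: "E \<in> FE \<Lambda> (src \<Lambda> b)"
    then obtain c where c: "initseg z c" "b \<sqsubseteq> cmp \<Lambda> a c" by (auto simp: yS S_def)
    obtain r where b: "b \<in> Mor \<Lambda>" and r: "r \<in> Mor \<Lambda>" "src \<Lambda> b = rng \<Lambda> r"
      and eq: "cmp \<Lambda> a c = cmp \<Lambda> b r"
      using c(2) by (rule prefix_ofE)
    have src: "src \<Lambda> r = src \<Lambda> c"
      using arg_cong[OF eq, of "src \<Lambda>"] a b r zc[OF c(1)] by (simp add: src_cmp)
    have E': "exhaustive \<Lambda> (src \<Lambda> b) E" "finite E" "E \<subseteq> Mor \<Lambda>"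
      using E by (auto simp: FE_def into_def)
    \<comment> \<open>\<open>E\<close> is based at \<open>src \<Lambda> b\<close>, which need not be
      a vertex of \<open>z\<close>. With \<open>ac = br\<close>, the set \<open>Ext r E\<close>
      carries it to \<open>src \<Lambda> c\<close>, where the boundary condition of \<open>z\<close>
      applies.\<close>
    have "exhaustive \<Lambda> (src \<Lambda> c) (Ext r E)"
      using exhaustive_Ext[OF E'(1), of r] r src by (simp add: into_def)
    then obtain p where p: "p \<in> Ext r E" "initseg z (cmp \<Lambda> c p)"
      by (rule boundary_exhaustive[OF zb c(1) finite_Ext[OF fa E'(2,3) r(1)]])
    obtain e where e: "e \<in> E" "p \<in> Mor \<Lambda>" "src \<Lambda> r = rng \<Lambda> p" "e \<sqsubseteq> cmp \<Lambda> r p"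
      by (rule mem_ExtE[OF p(1) r(1) E'(3)])
    have em: "e \<in> Mor \<Lambda>" "rng \<Lambda> e = src \<Lambda> b" using FE_into[OF E e(1)] by auto
    have "cmp \<Lambda> a (cmp \<Lambda> c p) = cmp \<Lambda> (cmp \<Lambda> a c) p"
      using a zc[OF c(1)] e src by (simp add: cmp_assoc)
    also have "\<dots> = cmp \<Lambda> b (cmp \<Lambda> r p)" unfolding eq using b r e by (simp add: cmp_assoc)
    finally have "cmp \<Lambda> b e \<sqsubseteq> cmp \<Lambda> a (cmp \<Lambda> c p)"
      using prefix_cmp_iff[OF b em(1), of "cmp \<Lambda> r p"] e em r by (simp add: cmp_closed rng_cmp)
    then have "initseg y (cmp \<Lambda> b e)" using p(2) unfolding yS S_def by blast
    then show "\<exists>e\<in>E. initseg y (cmp \<Lambda> b e)" using e(1) by blast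
  qed (rule y)
  then show thesis using ya sh by (rule that)
qed

text \<open>This is the uniqueness behind the definite description in
  \<open>prepend\<close>.\<close>

lemma initseg_shift_unique:
  assumes "x \<in> paths" "y \<in> paths" "initseg x a" "initseg y a"
    and "shift (deg \<Lambda> a) x = shift (deg \<Lambda> a) y"
  shows "x = y"
  by (rule paths_eqI[OF assms(1,2)])
     (simp add: initseg_via_shift[OF assms(1,3)] initseg_via_shift[OF assms(2,4)] assms(5))

lemma prepend_eq:
  assumes "y \<in> boundary_paths \<Lambda>" "initseg y a"
  shows "prepend \<Lambda> a (shift (deg \<Lambda> a) y) = y"
  unfolding prepend_def
proof (rule the_equality)
  fix y' assume "y' \<in> boundary_paths \<Lambda> \<and> edeg (deg \<Lambda> a) \<le> pdeg y' \<and> pmor y' 0 (deg \<Lambda> a) = a \<and>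
    shift (deg \<Lambda> a) y' = shift (deg \<Lambda> a) y"
  then show "y' = y"
    using assms by (intro initseg_shift_unique[of y' y a])
      (simp_all add: boundary_paths_path initseg_def)
qed (use assms in \<open>simp add: initseg_def\<close>)

lemma prepend_props:
  assumes "finitely_aligned \<Lambda>" "a \<in> Mor \<Lambda>" "z \<in> boundary_paths_at \<Lambda> (src \<Lambda> a)"
  shows "prepend \<Lambda> a z \<in> boundary_paths \<Lambda>" "initseg (prepend \<Lambda> a z) a"
    and "shift (deg \<Lambda> a) (prepend \<Lambda> a z) = z"
proof -
  obtain y where "y \<in> boundary_paths \<Lambda>" "initseg y a" "shift (deg \<Lambda> a) y = z"
    by (rule prepend_boundary_path[OF assms])
  moreover from this have "prepend \<Lambda> a z = y" using prepend_eq by blast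
  ultimately show "prepend \<Lambda> a z \<in> boundary_paths \<Lambda>" "initseg (prepend \<Lambda> a z) a"
    "shift (deg \<Lambda> a) (prepend \<Lambda> a z) = z" by simp_all
qed

lemma cylinder_iff:
  assumes "finitely_aligned \<Lambda>" "a \<in> Mor \<Lambda>"
  shows "x \<in> cylinder \<Lambda> a \<longleftrightarrow> x \<in> boundary_paths \<Lambda> \<and> initseg x a"
proof
  assume "x \<in> cylinder \<Lambda> a"
  then show "x \<in> boundary_paths \<Lambda> \<and> initseg x a"
    using prepend_props[OF assms] by (auto simp: cylinder_def)
next
  assume x: "x \<in> boundary_paths \<Lambda> \<and> initseg x a"
  then have "x = prepend \<Lambda> a (shift (deg \<Lambda> a) x)" using prepend_eq by simp
  then show "x \<in> cylinder \<Lambda> a"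
    unfolding cylinder_def using x shift_boundary by blast
qed

text \<open>
  The path is the limit of an increasing chain of morphisms along which every pair of a morphism
  \<open>a\<close> and a finite set \<open>E\<close> is visited infinitely often: if at such a visit \<open>a\<close> is a prefix and
  \<open>E\<close> is exhaustive at \<open>src \<Lambda> a\<close>, then the chain is extended past \<open>ae\<close> for some \<open>e\<close> in \<open>E\<close>.
\<close>

lemma boundary_path_exists:
  assumes v: "v \<in> Obj \<Lambda>"
  shows "boundary_paths_at \<Lambda> v \<noteq> {}"
proof -
  define P where "P = Mor \<Lambda> \<times> {E. finite E \<and> E \<subseteq> Mor \<Lambda>}"
  have P: "countable P" "(v, {}) \<in> P"
    using countable_Mor v by (auto simp: P_def Obj_Mor intro: countable_Collect_finite_subset)
  have step: "\<exists>l'. l \<sqsubseteq> l' \<and> (a \<sqsubseteq> l \<and> exhaustive \<Lambda> (src \<Lambda> a) E \<longrightarrow> (\<exists>e\<in>E. cmp \<Lambda> a e \<sqsubseteq> l'))"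
    if l: "l \<in> Mor \<Lambda>" for l a E
  proof (cases "a \<sqsubseteq> l \<and> exhaustive \<Lambda> (src \<Lambda> a) E")
    case True
    then obtain b where a: "a \<in> Mor \<Lambda>" and b: "b \<in> Mor \<Lambda>" "src \<Lambda> a = rng \<Lambda> b" "l = cmp \<Lambda> a b"
      by (auto elim: prefix_ofE)
    \<comment> \<open>Exhaustiveness is applied to the remainder \<open>b\<close> of
      \<open>l\<close> after \<open>a\<close>: if \<open>t\<close> extends both \<open>b\<close> and
      \<open>e\<close>, then \<open>at\<close> extends both \<open>l = ab\<close> and
      \<open>ae\<close>.\<close>
    then obtain e t where t: "e \<in> E" "b \<sqsubseteq> t" "e \<sqsubseteq> t" and e: "e \<in> Mor \<Lambda>" "rng \<Lambda> e = src \<Lambda> a"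
      using True by (fastforce simp: exhaustive_iff into_def)
    have "t \<in> Mor \<Lambda>" "rng \<Lambda> t = src \<Lambda> a" using prefix_Mor(2)[OF t(2)] prefix_rng[OF t(2)] b by auto
    then have "l \<sqsubseteq> cmp \<Lambda> a t" "cmp \<Lambda> a e \<sqsubseteq> cmp \<Lambda> a t"
      using prefix_cmp_iff[OF a] t b e by simp_all
    then show ?thesis using t(1) by blast
  qed (use prefix_refl[OF l] in blast)
  \<comment> \<open>The second component of \<open>prod_decode j\<close> is a free counter: the pair
    with index \<open>n\<close> recurs at \<open>prod_encode (n, i)\<close>, which is at least
    \<open>i\<close>, for every \<open>i\<close>. So it is visited after \<open>a\<close> has become
    a prefix.\<close>
  define en where "en j = from_nat_into P (fst (prod_decode j))" for j
  define Q where "Q j l l' \<longleftrightarrow> l \<sqsubseteq> l' \<and> (\<forall>a E. en j = (a, E) \<and> a \<sqsubseteq> l \<and> exhaustive \<Lambda> (src \<Lambda> a) E \<longrightarrow>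
      (\<exists>e\<in>E. cmp \<Lambda> a e \<sqsubseteq> l'))" for j l l'
  have "\<exists>f. \<forall>j. (f j \<in> Mor \<Lambda> \<and> (j = 0 \<longrightarrow> f j = v)) \<and> Q j (f j) (f (Suc j))"
  proof (rule dependent_nat_choice)
    show "\<exists>l. l \<in> Mor \<Lambda> \<and> ((0::nat) = 0 \<longrightarrow> l = v)" using v Obj_Mor by auto
  next
    fix l and j :: nat assume "l \<in> Mor \<Lambda> \<and> (j = 0 \<longrightarrow> l = v)"
    then have l: "l \<in> Mor \<Lambda>" ..
    obtain a E where aE: "en j = (a, E)" by fastforce
    obtain l' where "Q j l l'"
      using step[OF l, of a E] by (auto simp only: Q_def aE prod.inject)
    moreover from this have "l' \<in> Mor \<Lambda>" using prefix_Mor(2) unfolding Q_def by blast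
    ultimately show "\<exists>l'. (l' \<in> Mor \<Lambda> \<and> (Suc j = 0 \<longrightarrow> l' = v)) \<and> Q j l l'" by blast
  qed
  then obtain f where f: "\<And>j. f j \<in> Mor \<Lambda>" "f 0 = v" and fQ: "\<And>j. Q j (f j) (f (Suc j))"
    by blast
  then have f_Suc: "\<And>j. f j \<sqsubseteq> f (Suc j)"
    and f_hit: "\<And>j a E. \<lbrakk>en j = (a, E); a \<sqsubseteq> f j; exhaustive \<Lambda> (src \<Lambda> a) E\<rbrakk>
        \<Longrightarrow> \<exists>e\<in>E. cmp \<Lambda> a e \<sqsubseteq> f (Suc j)"
    by (auto simp: Q_def)
  have f_mono: "f i \<sqsubseteq> f j" if "i \<le> j" for i j
    using that by (induction rule: dec_induct) (use prefix_refl f(1) prefix_trans f_Suc in blast)+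
  have "\<exists>x\<in>paths. \<forall>b. initseg x b \<longleftrightarrow> b \<in> {b. \<exists>j. b \<sqsubseteq> f j}"
  proof (rule path_of_ideal)
    show "{b. \<exists>j. b \<sqsubseteq> f j} \<subseteq> Mor \<Lambda>" using prefix_Mor(1) by blast
    show "{b. \<exists>j. b \<sqsubseteq> f j} \<noteq> {}" using f_Suc by blast
  next
    fix a b assume "a \<in> {b. \<exists>j. b \<sqsubseteq> f j}" "b \<in> {b. \<exists>j. b \<sqsubseteq> f j}"
    then obtain i j where "a \<sqsubseteq> f i" "b \<sqsubseteq> f j" by blast
    then have "a \<sqsubseteq> f (max i j)" "b \<sqsubseteq> f (max i j)"
      using prefix_trans[OF _ f_mono] max.cobounded1 max.cobounded2 by blast+
    then show "\<exists>c\<in>{b. \<exists>j. b \<sqsubseteq> f j}. a \<sqsubseteq> c \<and> b \<sqsubseteq> c" using f_Suc by blast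
  qed (use prefix_trans in blast)
  then obtain x where x: "x \<in> paths" and xi: "\<And>b. initseg x b \<longleftrightarrow> (\<exists>j. b \<sqsubseteq> f j)" by blast
  have "x \<in> boundary_paths \<Lambda>"
    unfolding boundary_iff
  proof (intro conjI allI impI ballI)
    fix a E assume "initseg x a" and E: "E \<in> FE \<Lambda> (src \<Lambda> a)"
    then obtain i where i: "a \<sqsubseteq> f i" by (auto simp: xi)
    have "(a, E) \<in> P" using prefix_Mor(1)[OF i] E by (auto simp: P_def FE_def into_def)
    then obtain n where n: "from_nat_into P n = (a, E)"
      using P(1) by (metis from_nat_into_surj)
    define j where "j = prod_encode (n, i)"
    have "en j = (a, E)" by (simp add: en_def j_def n)
    moreover have "a \<sqsubseteq> f j"
      using prefix_trans[OF i f_mono] le_prod_encode_2 by (simp add: j_def)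
    moreover have "exhaustive \<Lambda> (src \<Lambda> a) E" using E by (simp add: FE_def)
    ultimately show "\<exists>e\<in>E. initseg x (cmp \<Lambda> a e)" using f_hit xi by blast
  qed (rule x)
  moreover have "initseg x v" using f_Suc[of 0] f(2) by (auto simp: xi)
  then have "pmor x 0 0 = v" using initseg_rng[OF x] Obj_rng[OF v] by simp
  ultimately show ?thesis unfolding boundary_paths_at_def by blast
qed

section \<open>The boundary-path groupoid\<close>

text \<open>The common tail \<open>z\<close> in the definition is the shift of either end; its range
  is both \<open>src \<Lambda> a\<close> and \<open>src \<Lambda> b\<close>, which makes these
  equal.\<close>

lemma Mor_bp_groupoid_iff:
  assumes "finitely_aligned \<Lambda>"
  shows "(x, m, y) \<in> Mor (bp_groupoid \<Lambda>) \<longleftrightarrow> x \<in> boundary_paths \<Lambda> \<and> y \<in> boundary_paths \<Lambda> \<and>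
    (\<exists>a b. initseg x a \<and> initseg y b \<and> m = deg_diff \<Lambda> a b \<and>
       shift (deg \<Lambda> a) x = shift (deg \<Lambda> b) y)"
  (is "?L \<longleftrightarrow> ?R")
proof
  assume ?L
  then obtain a b z where "a \<in> Mor \<Lambda>" "b \<in> Mor \<Lambda>" "z \<in> boundary_paths_at \<Lambda> (src \<Lambda> a)"
    "z \<in> boundary_paths_at \<Lambda> (src \<Lambda> b)" "x = prepend \<Lambda> a z" "y = prepend \<Lambda> b z"
    "m = deg_diff \<Lambda> a b"
    by (auto simp: bp_groupoid_def)
  then show ?R using prepend_props[OF assms] by metis
next
  assume ?R
  then obtain a b where ab: "x \<in> boundary_paths \<Lambda>" "initseg x a" "y \<in> boundary_paths \<Lambda>" "initseg y b"
    "m = deg_diff \<Lambda> a b" "shift (deg \<Lambda> a) x = shift (deg \<Lambda> b) y"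
    by blast
  define z where "z = shift (deg \<Lambda> a) x"
  have "z \<in> boundary_paths_at \<Lambda> (src \<Lambda> a)" "z \<in> boundary_paths_at \<Lambda> (src \<Lambda> b)"
    using shift_boundary[OF ab(1,2)] shift_boundary[OF ab(3,4)] ab(6) by (simp_all add: z_def)
  moreover from this have "src \<Lambda> a = src \<Lambda> b" by (simp add: boundary_paths_at_def)
  moreover have "x = prepend \<Lambda> a z" "y = prepend \<Lambda> b z"
    using prepend_eq[OF ab(1,2)] prepend_eq[OF ab(3,4)] ab(6) by (simp_all add: z_def)
  moreover have "a \<in> Mor \<Lambda>" "b \<in> Mor \<Lambda>"
    using ab boundary_paths_path initseg_Mor by blast+
  ultimately show ?L using ab(5) unfolding bp_groupoid_def cat.select_convs mem_Collect_eq by blast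
qed

lemma Obj_bp_groupoid:
  assumes "finitely_aligned \<Lambda>"
  shows "Obj (bp_groupoid \<Lambda>) = (\<lambda>x. (x, 0, x)) ` boundary_paths \<Lambda>"
proof -
  have "(x, 0, x) \<in> Mor (bp_groupoid \<Lambda>)" if x: "x \<in> boundary_paths \<Lambda>" for x
  proof -
    have "initseg x (pmor x 0 0)" using x boundary_paths_path initseg_range by blast
    moreover have "deg_diff \<Lambda> (pmor x 0 0) (pmor x 0 0) = 0"
      by (simp add: deg_diff_def fun_eq_iff)
    ultimately show ?thesis using x by (auto simp: Mor_bp_groupoid_iff[OF assms] intro!: exI)
  qed
  moreover have "x \<in> boundary_paths \<Lambda>" if "(x, m, y) \<in> Mor (bp_groupoid \<Lambda>)" for x m y
    using that by (simp add: Mor_bp_groupoid_iff[OF assms])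
  moreover have "rng (bp_groupoid \<Lambda>) (x, m, y) = (x, 0, x)" for x m y
    by (simp add: bp_groupoid_def)
  ultimately show ?thesis by (auto simp: Obj_def)
qed

section \<open>The topology on the unit space\<close>

lemma unit_mem_cylinder2_minus_iff:
  assumes fa: "finitely_aligned \<Lambda>" and ab: "a \<in> Mor \<Lambda>" "b \<in> Mor \<Lambda>" "src \<Lambda> a = src \<Lambda> b"
    and F: "F \<subseteq> into \<Lambda> (src \<Lambda> a)" and x: "x \<in> boundary_paths \<Lambda>"
  shows "(x, 0, x) \<in> cylinder2_minus \<Lambda> a b F \<longleftrightarrow>
    a = b \<and> initseg x a \<and> (\<forall>c\<in>F. \<not> initseg x (cmp \<Lambda> a c))"
proof -
  have *: "(x, 0, x) \<in> cylinder2 \<Lambda> a b \<longleftrightarrow> a = b \<and> initseg x a"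
    if "a \<in> Mor \<Lambda>" "b \<in> Mor \<Lambda>" for a b
  proof
    assume "(x, 0, x) \<in> cylinder2 \<Lambda> a b"
    then have d: "deg_diff \<Lambda> a b = 0" and i: "initseg x a" "initseg x b"
      using cylinder_iff[OF fa] that by (auto simp: cylinder2_def)
    \<comment> \<open>Initial segments of one path with equal degrees coincide; hence a basic set
      with different \<open>a\<close> and \<open>b\<close> contains no unit.\<close>
    have "deg \<Lambda> a = deg \<Lambda> b" using d by (simp add: deg_diff_def fun_eq_iff)
    then show "a = b \<and> initseg x a" using i by (simp add: initseg_def)
  next
    assume i: "a = b \<and> initseg x a"
    have "deg_diff \<Lambda> a a = 0" by (simp add: deg_diff_def fun_eq_iff)
    moreover have "(x, 0, x) \<in> Mor (bp_groupoid \<Lambda>)"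
      using Obj_bp_groupoid[OF fa] x by (auto simp: Obj_def)
    ultimately show "(x, 0, x) \<in> cylinder2 \<Lambda> a b"
      using cylinder_iff[OF fa that(1)] x i by (auto simp: cylinder2_def)
  qed
  have "(x, 0, x) \<in> cylinder2 \<Lambda> (cmp \<Lambda> a c) (cmp \<Lambda> a c) \<longleftrightarrow> initseg x (cmp \<Lambda> a c)"
    if "c \<in> F" for c
  proof -
    have "cmp \<Lambda> a c \<in> Mor \<Lambda>" using that F ab(1) by (auto simp: into_def intro!: cmp_closed)
    from *[OF this this] show ?thesis by simp
  qed
  then show ?thesis
    unfolding cylinder2_minus_def using *[OF ab(1,2)] by (cases "a = b") (simp_all del: split_paired_All)
qed

text \<open>Induction on how the open set is generated from \<open>bp_basis\<close>. The excluded
  morphisms are recorded absolutely, as \<open>ac\<close> instead of \<open>c\<close>: for an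
  intersection they are simply united, while \<open>a\<close> and \<open>b\<close> are replaced by a
  common extension \<open>d\<close> inside \<open>x\<close>.\<close>

lemma unit_neighbourhood:
  assumes fa: "finitely_aligned \<Lambda>" and T: "openin (bp_topology \<Lambda>) T"
    and x: "x \<in> boundary_paths \<Lambda>" "(x, 0, x) \<in> T"
  obtains a F where "initseg x a" "finite F" "F \<subseteq> Mor \<Lambda>" "\<forall>c\<in>F. \<not> initseg x c"
    "\<forall>y\<in>boundary_paths \<Lambda>. initseg y a \<and> (\<forall>c\<in>F. \<not> initseg y c) \<longrightarrow> (y, 0, y) \<in> T"
proof -
  define N where "N T a F \<longleftrightarrow> initseg x a \<and> finite F \<and> F \<subseteq> Mor \<Lambda> \<and> (\<forall>c\<in>F. \<not> initseg x c) \<and>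
    (\<forall>y\<in>boundary_paths \<Lambda>. initseg y a \<and> (\<forall>c\<in>F. \<not> initseg y c) \<longrightarrow> (y, 0, y) \<in> T)"
    for T :: "('a, 'k) bp_arrow set" and a F
  have "generate_topology_on (bp_basis \<Lambda>) T"
    using T by (simp add: bp_topology_def openin_topology_generated_by_iff)
  then have "(x, 0, x) \<in> T \<Longrightarrow> \<exists>a F. N T a F"
  proof (induction rule: generate_topology_on.induct)
    case Empty
    then show ?case by simp
  next
    case (Int S T)
    then obtain a F b G where "N S a F" "N T b G" by blast
    note 1 = this(1)[unfolded N_def] and 2 = this(2)[unfolded N_def]
    obtain d where d: "initseg x d" "a \<sqsubseteq> d" "b \<sqsubseteq> d"
      by (rule initseg_directed[OF boundary_paths_path[OF x(1)] conjunct1[OF 1] conjunct1[OF 2]])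
    have "\<forall>y\<in>boundary_paths \<Lambda>. initseg y d \<and> (\<forall>c\<in>F \<union> G. \<not> initseg y c) \<longrightarrow> (y, 0, y) \<in> S \<inter> T"
    proof (intro ballI impI)
      fix y assume y: "y \<in> boundary_paths \<Lambda>" and *: "initseg y d \<and> (\<forall>c\<in>F \<union> G. \<not> initseg y c)"
      then have "initseg y a" "initseg y b"
        using initseg_prefix[OF boundary_paths_path[OF y] conjunct1[OF *]] d(2,3) by simp_all
      then show "(y, 0, y) \<in> S \<inter> T" using 1 2 y * by simp
    qed
    then have "N (S \<inter> T) d (F \<union> G)" unfolding N_def using d(1) 1 2 by auto
    then show ?case by blast
  next
    case (UN K)
    then obtain k where k: "k \<in> K" "(x, 0, x) \<in> k" by blast
    from UN.IH[OF this] obtain a F where "N k a F" by blast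
    then have "N (\<Union>K) a F" using k(1) unfolding N_def by blast
    then show ?case by blast
  next
    case (Basis T)
    then obtain a b F where ab: "a \<in> Mor \<Lambda>" "b \<in> Mor \<Lambda>" "src \<Lambda> a = src \<Lambda> b"
      and F: "F \<subseteq> into \<Lambda> (src \<Lambda> a)" "finite F" and T: "T = cylinder2_minus \<Lambda> a b F"
      by (auto simp: bp_basis_def)
    note * = unit_mem_cylinder2_minus_iff[OF fa ab F(1)]
    have "a = b \<and> initseg x a \<and> (\<forall>c\<in>F. \<not> initseg x (cmp \<Lambda> a c))"
      using *[OF x(1)] Basis.prems unfolding T by blast
    moreover have "cmp \<Lambda> a ` F \<subseteq> Mor \<Lambda>" using F(1) ab(1) by (auto simp: into_def intro!: cmp_closed)
    moreover have "finite (cmp \<Lambda> a ` F)" using F(2) by simp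
    moreover have "(y, 0, y) \<in> T"
      if "y \<in> boundary_paths \<Lambda>" "initseg y a" "\<forall>c\<in>cmp \<Lambda> a ` F. \<not> initseg y c" for y
    proof -
      have "\<forall>c\<in>F. \<not> initseg y (cmp \<Lambda> a c)" using that(3) by blast
      then show ?thesis using *[OF that(1)] that(2) calculation(1) unfolding T by blast
    qed
    ultimately have "N T a (cmp \<Lambda> a ` F)" unfolding N_def ball_simps by blast
    then show ?case by blast
  qed
  then obtain a F where "N T a F" using x(2) by blast
  then show thesis using that unfolding N_def by blast
qed

text \<open>If \<open>Ext a F\<close> were exhaustive, the boundary condition would force
  \<open>x\<close> through some \<open>ap\<close> with \<open>p\<close> in \<open>Ext a F\<close>,
  and thereby through a member of \<open>F\<close>. So some \<open>r\<close> has no common extension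
  with any member of \<open>Ext a F\<close>, and \<open>b\<close> is the product
  \<open>ar\<close>.\<close>

lemma disjoint_extension:
  assumes fa: "finitely_aligned \<Lambda>" and x: "x \<in> boundary_paths \<Lambda>" "initseg x a"
    and F: "finite F" "F \<subseteq> Mor \<Lambda>" "\<forall>c\<in>F. \<not> initseg x c"
  obtains b where "a \<sqsubseteq> b" "\<forall>c\<in>F. \<forall>t. b \<sqsubseteq> t \<longrightarrow> \<not> c \<sqsubseteq> t"
proof -
  note xp = boundary_paths_path[OF x(1)]
  have a: "a \<in> Mor \<Lambda>" using initseg_Mor[OF xp x(2)] .
  have "\<not> exhaustive \<Lambda> (src \<Lambda> a) (Ext a F)"
  proof
    assume "exhaustive \<Lambda> (src \<Lambda> a) (Ext a F)"
    then obtain p where p: "p \<in> Ext a F" "initseg x (cmp \<Lambda> a p)"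
      by (rule boundary_exhaustive[OF x finite_Ext[OF fa F(1,2) a]])
    obtain c where "c \<in> F" "c \<sqsubseteq> cmp \<Lambda> a p" by (rule mem_ExtE[OF p(1) a F(2)])
    then show False using F(3) initseg_prefix[OF xp p(2)] by blast
  qed
  then obtain r where "r \<in> into \<Lambda> (src \<Lambda> a)"
    and disj: "\<forall>p\<in>Ext a F. \<forall>t. r \<sqsubseteq> t \<longrightarrow> \<not> p \<sqsubseteq> t"
    using Ext_into[OF a F(2)] unfolding exhaustive_iff by blast
  then have r: "r \<in> Mor \<Lambda>" "src \<Lambda> a = rng \<Lambda> r" by (auto simp: into_def)
  show thesis
  proof (rule that)
    show ab: "a \<sqsubseteq> cmp \<Lambda> a r" using prefix_ofI[OF a r] .
    show "\<forall>c\<in>F. \<forall>t. cmp \<Lambda> a r \<sqsubseteq> t \<longrightarrow> \<not> c \<sqsubseteq> t"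
    proof (intro ballI allI impI notI)
      fix c t assume c: "c \<in> F" and t: "cmp \<Lambda> a r \<sqsubseteq> t" and "c \<sqsubseteq> t"
      have at: "a \<sqsubseteq> t" using prefix_trans[OF ab t] .
      \<comment> \<open>A common extension of \<open>ar\<close> and \<open>c\<close> lies above some
        \<open>ap\<close> with \<open>p\<close> in \<open>Ext a F\<close>; cancelling
        \<open>a\<close> gives a forbidden common extension of \<open>r\<close> and
        \<open>p\<close>.\<close>
      obtain p where p: "p \<in> Ext a F" "cmp \<Lambda> a p \<sqsubseteq> t" by (rule Ext_below[OF at \<open>c \<sqsubseteq> t\<close> c])
      obtain s where s: "s \<in> Mor \<Lambda>" "src \<Lambda> a = rng \<Lambda> s" "t = cmp \<Lambda> a s" using at by (rule prefix_ofE)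
      have "p \<in> Mor \<Lambda>" "src \<Lambda> a = rng \<Lambda> p" using mem_ExtE[OF p(1) a F(2)] by auto
      then have "p \<sqsubseteq> s" "r \<sqsubseteq> s"
        using prefix_cmp_iff[OF a _ s(1) _ s(2)] p(2) t r s(3) by simp_all
      then show False using disj p(1) by blast
    qed
  qed
qed

text \<open>Two initial segments of one path have a common extension, so paths through
  \<open>b\<close> avoid \<open>F\<close>. The point \<open>x\<close> itself need not pass through
  \<open>b\<close>; some full cylinder inside the open set is enough.\<close>

lemma unit_cylinder_in_open:
  assumes fa: "finitely_aligned \<Lambda>" and T: "openin (bp_topology \<Lambda>) T"
    and x: "x \<in> boundary_paths \<Lambda>" "(x, 0, x) \<in> T"
  shows "\<exists>b\<in>Mor \<Lambda>. \<forall>y\<in>boundary_paths \<Lambda>. initseg y b \<longrightarrow> (y, 0, y) \<in> T"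
proof -
  obtain a F where a: "initseg x a" and F: "finite F" "F \<subseteq> Mor \<Lambda>" "\<forall>c\<in>F. \<not> initseg x c"
    and nbh: "\<forall>y\<in>boundary_paths \<Lambda>. initseg y a \<and> (\<forall>c\<in>F. \<not> initseg y c) \<longrightarrow> (y, 0, y) \<in> T"
    by (rule unit_neighbourhood[OF fa T x])
  obtain b where b: "a \<sqsubseteq> b" "\<forall>c\<in>F. \<forall>t. b \<sqsubseteq> t \<longrightarrow> \<not> c \<sqsubseteq> t"
    by (rule disjoint_extension[OF fa x(1) a F])
  have "(y, 0, y) \<in> T" if y: "y \<in> boundary_paths \<Lambda>" "initseg y b" for y
  proof -
    note yp = boundary_paths_path[OF y(1)]
    have "\<not> initseg y c" if "c \<in> F" for c using initseg_directed[OF yp y(2)] b(2) that by metis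
    then show ?thesis using nbh y(1) initseg_prefix[OF yp y(2) b(1)] by blast
  qed
  then show ?thesis using prefix_Mor(2)[OF b(1)] by blast
qed

lemma openin_unit_cylinder:
  assumes fa: "finitely_aligned \<Lambda>" and a: "a \<in> Mor \<Lambda>"
  shows "openin (subtopology (bp_topology \<Lambda>) (Obj (bp_groupoid \<Lambda>)))
    {(x, 0, x) | x. x \<in> boundary_paths \<Lambda> \<and> initseg x a}"
proof -
  have "src \<Lambda> a \<in> into \<Lambda> (src \<Lambda> a)" using a by (simp add: into_def src_closed rng_src)
  \<comment> \<open>The vertex \<open>src \<Lambda> a\<close> has no partner in the empty set, so
    removing nothing gives an admissible basic set.\<close>
  then have "\<not> exhaustive \<Lambda> (src \<Lambda> a) {}" by (auto simp: exhaustive_def)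
  then have "cylinder2_minus \<Lambda> a a {} \<in> bp_basis \<Lambda>"
    using a by (force simp: bp_basis_def)
  then have "openin (bp_topology \<Lambda>) (cylinder2_minus \<Lambda> a a {})"
    by (simp add: bp_topology_def openin_topology_generated_by_iff generate_topology_on.Basis)
  moreover have "{(x, 0, x) | x. x \<in> boundary_paths \<Lambda> \<and> initseg x a} =
      cylinder2_minus \<Lambda> a a {} \<inter> Obj (bp_groupoid \<Lambda>)"
    using unit_mem_cylinder2_minus_iff[OF fa a a refl, of "{}"] by (auto simp: Obj_bp_groupoid[OF fa])
  ultimately show ?thesis unfolding openin_subtopology by blast
qed

section \<open>Cofinality and minimality\<close>

lemma cofinal_kgraph_iff:
  "cofinal_kgraph \<Lambda> \<longleftrightarrow> (\<forall>v\<in>Obj \<Lambda>. \<forall>x\<in>boundary_paths \<Lambda>.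
     \<exists>a b. initseg x a \<and> b \<in> Mor \<Lambda> \<and> rng \<Lambda> b = v \<and> src \<Lambda> b = src \<Lambda> a)"
proof -
  have "(\<exists>n. edeg n \<le> pdeg x \<and> {b \<in> Mor \<Lambda>. rng \<Lambda> b = v \<and> src \<Lambda> b = pmor x n n} \<noteq> {}) \<longleftrightarrow>
      (\<exists>a b. initseg x a \<and> b \<in> Mor \<Lambda> \<and> rng \<Lambda> b = v \<and> src \<Lambda> b = src \<Lambda> a)"
    (is "?L \<longleftrightarrow> ?R")
    if "x \<in> boundary_paths \<Lambda>" for x v
  proof
    note xp = boundary_paths_path[OF that]
    {
      assume ?L
      then obtain n b where n: "edeg n \<le> pdeg x" and b: "b \<in> Mor \<Lambda>" "rng \<Lambda> b = v" "src \<Lambda> b = pmor x n n"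
        by blast
      have "initseg x (pmor x 0 n)" "src \<Lambda> (pmor x 0 n) = pmor x n n"
        using n xp by (simp_all add: initseg_pmor src_pmor)
      then show ?R using b by metis
    next
      assume ?R
      then obtain a b where a: "initseg x a" and b: "b \<in> Mor \<Lambda>" "rng \<Lambda> b = v" "src \<Lambda> b = src \<Lambda> a"
        by blast
      have "edeg (deg \<Lambda> a) \<le> pdeg x" "src \<Lambda> a = pmor x (deg \<Lambda> a) (deg \<Lambda> a)"
        using a initseg_src[OF xp a] by (simp_all add: initseg_def)
      then show ?L using b by auto
    }
  qed
  then show ?thesis unfolding cofinal_kgraph_def by simp
qed

lemma minimal_if_cofinal:
  assumes fa: "finitely_aligned \<Lambda>" and cof: "cofinal_kgraph \<Lambda>"
  shows "minimal_groupoid (bp_groupoid \<Lambda>) (bp_topology \<Lambda>)"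
  unfolding minimal_groupoid_def
proof (intro allI impI)
  let ?G = "bp_groupoid \<Lambda>"
  fix U assume U: "openin (subtopology (bp_topology \<Lambda>) (Obj ?G)) U \<and> invariant ?G U"
  then obtain T where T: "openin (bp_topology \<Lambda>) T" "U = T \<inter> Obj ?G"
    by (auto simp: openin_subtopology)
  show "U = {} \<or> U = Obj ?G"
  proof (cases "U = {}")
    case False
    then obtain x where x: "x \<in> boundary_paths \<Lambda>" "(x, 0, x) \<in> T"
      using T(2) by (auto simp: Obj_bp_groupoid[OF fa])
    obtain b where b: "b \<in> Mor \<Lambda>"
      and bU: "\<And>y. \<lbrakk>y \<in> boundary_paths \<Lambda>; initseg y b\<rbrakk> \<Longrightarrow> (y, 0, y) \<in> T"
      using unit_cylinder_in_open[OF fa T(1) x] by blast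
    have "(y, 0, y) \<in> U" if y: "y \<in> boundary_paths \<Lambda>" for y
    proof -
      obtain a c where a: "initseg y a" and c: "c \<in> Mor \<Lambda>" "rng \<Lambda> c = src \<Lambda> b" "src \<Lambda> c = src \<Lambda> a"
        using cof y src_Obj[OF b] unfolding cofinal_kgraph_iff by metis
      define z where "z = shift (deg \<Lambda> a) y"
      have bc: "cmp \<Lambda> b c \<in> Mor \<Lambda>" "src \<Lambda> (cmp \<Lambda> b c) = src \<Lambda> a"
        using b c by (simp_all add: cmp_closed src_cmp)
      then have "z \<in> boundary_paths_at \<Lambda> (src \<Lambda> (cmp \<Lambda> b c))"
        using shift_boundary[OF y a] by (simp add: z_def)
      note w = prepend_props[OF fa bc(1) this]
      let ?w = "prepend \<Lambda> (cmp \<Lambda> b c) z"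
      have "initseg ?w b"
        using initseg_prefix[OF boundary_paths_path[OF w(1)] w(2)] prefix_ofI[OF b c(1)] c(2) by simp
      then have "(?w, 0, ?w) \<in> U" using bU[OF w(1)] w(1) T(2) by (auto simp: Obj_bp_groupoid[OF fa])
      \<comment> \<open>Invariance passes from the source of an arrow to its range, so
        \<open>?w\<close> has to be the source and \<open>y\<close> the range. Both have the tail
        \<open>z\<close>.\<close>
      moreover have "(y, deg_diff \<Lambda> a (cmp \<Lambda> b c), ?w) \<in> Mor ?G"
        unfolding Mor_bp_groupoid_iff[OF fa] using y a w z_def by metis
      moreover have "src ?G (y, m, w) = (w, 0, w)" "rng ?G (y, m, w) = (y, 0, y)" for m w
        by (simp_all add: bp_groupoid_def)
      ultimately show ?thesis using U unfolding invariant_def by metis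
    qed
    then have "Obj ?G \<subseteq> U" unfolding Obj_bp_groupoid[OF fa] by blast
    then show ?thesis using T(2) by blast
  qed simp
qed

lemma cofinal_if_minimal:
  assumes fa: "finitely_aligned \<Lambda>" and min: "minimal_groupoid (bp_groupoid \<Lambda>) (bp_topology \<Lambda>)"
  shows "cofinal_kgraph \<Lambda>"
  unfolding cofinal_kgraph_iff
proof (intro ballI)
  let ?G = "bp_groupoid \<Lambda>"
  fix v x assume v: "v \<in> Obj \<Lambda>" and x: "x \<in> boundary_paths \<Lambda>"
  define R where "R y a \<longleftrightarrow> initseg y a \<and> (\<exists>b. b \<in> Mor \<Lambda> \<and> rng \<Lambda> b = v \<and> src \<Lambda> b = src \<Lambda> a)" for y a
  define U where "U = {(y, 0 :: 'k \<Rightarrow> int, y) | y. y \<in> boundary_paths \<Lambda> \<and> (\<exists>a. R y a)}"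
  \<comment> \<open>The connecting morphism for \<open>a\<close> is prolonged by the remainder of
    \<open>b\<close> after \<open>a\<close>, so a connected initial segment may be replaced by any
    longer one.\<close>
  have R_mono: "R y b" if Rab: "R y a" "a \<sqsubseteq> b" and y: "initseg y b" for y a b
  proof -
    obtain c d where "c \<in> Mor \<Lambda>" "src \<Lambda> a = rng \<Lambda> c" "b = cmp \<Lambda> a c" "a \<in> Mor \<Lambda>"
      and "d \<in> Mor \<Lambda>" "rng \<Lambda> d = v" "src \<Lambda> d = src \<Lambda> a"
      using Rab unfolding R_def prefix_of_def by blast
    then have "cmp \<Lambda> d c \<in> Mor \<Lambda> \<and> rng \<Lambda> (cmp \<Lambda> d c) = v \<and> src \<Lambda> (cmp \<Lambda> d c) = src \<Lambda> b"
      by (simp add: cmp_closed rng_cmp src_cmp)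
    then show ?thesis using y unfolding R_def by blast
  qed
  have "openin (subtopology (bp_topology \<Lambda>) (Obj ?G)) U"
  proof (subst openin_subopen, intro ballI)
    fix u assume "u \<in> U"
    then obtain y a where y: "u = (y, 0, y)" "y \<in> boundary_paths \<Lambda>" "R y a" by (auto simp: U_def)
    let ?Z = "{(x, 0 :: 'k \<Rightarrow> int, x) | x. x \<in> boundary_paths \<Lambda> \<and> initseg x a}"
    have "a \<in> Mor \<Lambda>" using initseg_Mor[OF boundary_paths_path[OF y(2)]] y(3) by (simp add: R_def)
    then have "openin (subtopology (bp_topology \<Lambda>) (Obj ?G)) ?Z"
      by (rule openin_unit_cylinder[OF fa])
    moreover have "u \<in> ?Z" "?Z \<subseteq> U" using y unfolding R_def U_def by blast+
    ultimately show "\<exists>T. openin (subtopology (bp_topology \<Lambda>) (Obj ?G)) T \<and> u \<in> T \<and> T \<subseteq> U"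
      by blast
  qed
  moreover have "invariant ?G U"
    unfolding invariant_def
  proof (intro conjI ballI impI)
    show "U \<subseteq> Obj ?G" by (auto simp: U_def Obj_bp_groupoid[OF fa])
    fix g assume g: "g \<in> Mor ?G" "src ?G g \<in> U"
    obtain x m y where xmy: "g = (x, m, y)" by (cases g)
    have "(y, 0, y) \<in> U" using g(2) by (simp add: xmy bp_groupoid_def)
    then obtain c where c: "R y c" by (auto simp: U_def)
    obtain a b where x: "x \<in> boundary_paths \<Lambda>" "initseg x a" and y: "y \<in> boundary_paths \<Lambda>" "initseg y b"
      and sh: "shift (deg \<Lambda> a) x = shift (deg \<Lambda> b) y"
      using g(1) unfolding xmy Mor_bp_groupoid_iff[OF fa] by blast
    note xp = boundary_paths_path[OF x(1)] and yp = boundary_paths_path[OF y(1)]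
    \<comment> \<open>The connected segment \<open>c\<close> and the segment \<open>b\<close> of the
      arrow may be incomparable. Above both lies \<open>d = be\<close>; as \<open>e\<close> belongs
      to the common tail, \<open>ae\<close> is an initial segment of \<open>x\<close> with the
      source of \<open>d\<close>.\<close>
    obtain d where d: "initseg y d" "c \<sqsubseteq> d" "b \<sqsubseteq> d"
      using initseg_directed[OF yp _ y(2)] c unfolding R_def by metis
    obtain e where e: "b \<in> Mor \<Lambda>" "e \<in> Mor \<Lambda>" "src \<Lambda> b = rng \<Lambda> e" "d = cmp \<Lambda> b e"
      using d(3) by (rule prefix_ofE)
    have "initseg (shift (deg \<Lambda> a) x) e"
      unfolding sh initseg_shift[OF yp y(2)] using d(1) e by simp
    then have ae: "initseg x (cmp \<Lambda> a e)" "rng \<Lambda> e = src \<Lambda> a"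
      unfolding initseg_shift[OF xp x(2)] by auto
    have "src \<Lambda> (cmp \<Lambda> a e) = src \<Lambda> d"
      using e ae(2) initseg_Mor[OF xp x(2)] by (simp add: src_cmp)
    then have "R x (cmp \<Lambda> a e)" using R_mono[OF c d(2,1)] ae(1) by (simp add: R_def)
    then have "(x, 0, x) \<in> U" using x(1) unfolding U_def by blast
    then show "rng ?G g \<in> U" by (simp add: xmy bp_groupoid_def)
  qed
  moreover have "U \<noteq> {}"
  proof -
    obtain y where y: "y \<in> boundary_paths \<Lambda>" "pmor y 0 0 = v"
      using boundary_path_exists[OF v] by (auto simp: boundary_paths_at_def)
    \<comment> \<open>At the first vertex of \<open>y\<close> the identity \<open>v\<close> itself
      is the connecting morphism.\<close>
    then have "R y v"
      using initseg_range[OF boundary_paths_path[OF y(1)]] v Obj_Mor Obj_rng unfolding R_def by metis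
    then have "(y, 0, y) \<in> U" using y(1) unfolding U_def by blast
    then show ?thesis by blast
  qed
  ultimately have "U = Obj ?G" using min unfolding minimal_groupoid_def by blast
  then have "(x, 0, x) \<in> U" using x by (simp add: Obj_bp_groupoid[OF fa])
  then show "\<exists>a b. initseg x a \<and> b \<in> Mor \<Lambda> \<and> rng \<Lambda> b = v \<and> src \<Lambda> b = src \<Lambda> a"
    by (auto simp: U_def R_def)
qed

end

theorem proposition7p1:
  fixes \<Lambda> :: "('a, 'k::finite) kgraph"
  assumes "k_graph \<Lambda>" and "finitely_aligned \<Lambda>"
  shows "cofinal_kgraph \<Lambda> \<longleftrightarrow> minimal_groupoid (bp_groupoid \<Lambda>) (bp_topology \<Lambda>)"
proof -
  interpret k_graph \<Lambda> by (rule assms(1))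
  show ?thesis using minimal_if_cofinal cofinal_if_minimal assms(2) by blast
qed

end
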